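(* Let $\sigma_1=x+y+z$, $\sigma_2=xy+yz+xz$, $\sigma_3=xyz$, and consider the polynomial with indeterminate coefficients $k_2,k_4,k_6,k_8$ $$P_2(z;x,y)=\sigma_1^2-4\sigma_2+k_2\sigma_3+k_8\sigma_3^2+k_4\sigma_1\sigma_3+k_6\sigma_2\sigma_3 ,$$ which is the general form of a polynomial that satisfies all the conditions defining a symmetric 2-algebraic 2-valued group over $\mathbb{C}$ with the possible exception of associativity. Let $\mathcal I\subset\mathbb{C}[k_2,k_4,k_6,k_8]$ be the ideal of relations on the coefficients imposed by the associativity axiom. Then $\mathcal I=(4k_8-k_4^2+k_6k_2)$; that is, the universal symmetric 2-algebraic 2-valued group over $\mathbb{C}$ is defined over the coefficient ring $$\mathbb{C}[k_2,k_4,k_6,k_8]/(4k_8-k_4^2+k_6k_2)\cong\mathbb{C}[k_2,k_4,k_6].$$ Equivalently, after replacing $k_j$ by $2k_j$ for $j=2,4,6$, the universal family of polynomials has the form $$P_2(z;x,y)=\sigma_1^2-4\sigma_2+2k_2\sigma_3+(k_4^2-k_6k_2)\sigma_3^2+2k_4\sigma_1\sigma_3+2k_6\sigma_2\sigma_3 .$$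
   Context: An $n$-algebraic $n$-valued group on $\mathbb{C}$ is given by a polynomial $P(z;x,y)=\sum_{k=0}^n F_{n-k}(x,y)z^k$ with $F_{i}\in\mathbb{C}[x,y]$, of degree at most $n$ in each of $x,y,z$; the product of $x$ and $y$ (with $F_0(x,y)\ne0$) is the multiset $[z_1(x,y),\dots,z_n(x,y)]$ of roots of $P$ in $z$. It is required that: (a) $F_0(0,0)=1$; (b) (neutral element $0$) $P(z;0,y)=F_0(0,y)(z-y)^n$; (c) (inverse) there is an algebraic map $\mathrm{inv}:\mathbb{C}\to\mathbb{C}$ with $F_n(x,\mathrm{inv}(x))=F_n(\mathrm{inv}(x),x)=0$ for all $x$; (d) (associativity) $\prod_{j,k=1}^n\bigl(t-z_j(z_k(x,y),z)\bigr)=\prod_{j,k=1}^n\bigl(t-z_j(x,z_k(y,z))\bigr)$ identically in $t$, with $x,y,z$ independent variables. It is symmetric if the polynomial $P(z;(-1)^nx,(-1)^ny)$ is symmetric in $x,y,z$. The ideal $\mathcal I$: for $n=2$ write $P_2=a(x,y)z^2+b(x,y)z+c(x,y)$ with coefficients in $S=\mathbb{C}[k_2,k_4,k_6,k_8]$. Let $L(t)=\sum_{i=0}^4L_it^i=a(x,y)^2\prod_{k=1}^2P_2(t;z_k(x,y),z)$ and $R(t)=\sum_{i=0}^4R_it^i=a(y,z)^2\prod_{k=1}^2P_2(t;x,z_k(y,z))$. By Vieta's formulas $L_i,R_i\in S[x,y,z]$, and associativity says $L(t)/L_4=R(t)/R_4$. The ideal $\mathcal I$ is generated by all coefficients (elements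 of $S$) of the polynomials $L_iR_4-L_4R_i\in S[x,y,z]$, $i=0,1,2,3$. *)

theory Defs
  imports
    "HOL-Algebra.Algebraic_Closure_Type"
    "HOL-Algebra.QuotRing"
    "HOL-Library.FuncSet"
begin

section \<open>Polynomials in three variables\<close>

text \<open>
  Elements of \<open>R[x,y,z]\<close> are values of type \<open>'r poly poly poly\<close>, the innermost variable being
  \<open>x\<close>, the middle one \<open>y\<close> and the outermost one \<open>z\<close>; elements of \<open>R[x,y]\<close> are values of type
  \<open>'r poly poly\<close> (inner variable \<open>x\<close>, outer variable \<open>y\<close>). Thus \<open>Polynomial.coeff P k\<close> is the
  coefficient of \<open>z ^ k\<close>, an element of \<open>R[x,y]\<close>.
\<close>

definition const3 :: "'r::comm_ring_1 \<Rightarrow> 'r poly poly poly" where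
  "const3 c = [:[:[:c:]:]:]"

definition var_x :: "'r::comm_ring_1 poly poly poly" where
  "var_x = [:[:[:0, 1:]:]:]"

definition var_y :: "'r::comm_ring_1 poly poly poly" where
  "var_y = [:[:0, 1:]:]"

definition var_z :: "'r::comm_ring_1 poly poly poly" where
  "var_z = [:0, 1:]"

text \<open>
  In the following three definitions \<open>h\<close> is a ring homomorphism, through which the coefficients
  are read in the ring that contains the arguments: \<open>eval2 h F a b\<close> is \<open>F(a,b)\<close>,
  \<open>fiber h P a b\<close> is the univariate polynomial \<open>P(z;a,b)\<close> in \<open>z\<close>, and \<open>eval3 h P a b c\<close> is
  \<open>P(c;a,b)\<close>.
\<close>

definition eval2 ::
  "('r::comm_ring_1 \<Rightarrow> 'b::comm_ring_1) \<Rightarrow> 'r poly poly \<Rightarrow> 'b \<Rightarrow> 'b \<Rightarrow> 'b" where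
  "eval2 h F a b = poly (map_poly (\<lambda>q. poly (map_poly h q) a) F) b"

definition fiber ::
  "('r::comm_ring_1 \<Rightarrow> 'b::comm_ring_1) \<Rightarrow> 'r poly poly poly \<Rightarrow> 'b \<Rightarrow> 'b \<Rightarrow> 'b poly" where
  "fiber h P a b = map_poly (\<lambda>F. eval2 h F a b) P"

definition eval3 ::
  "('r::comm_ring_1 \<Rightarrow> 'b::comm_ring_1) \<Rightarrow> 'r poly poly poly \<Rightarrow> 'b \<Rightarrow> 'b \<Rightarrow> 'b \<Rightarrow> 'b" where
  "eval3 h P a b c = poly (fiber h P a b) c"

definition map_poly3 :: "('r::comm_ring_1 \<Rightarrow> 's::comm_ring_1) \<Rightarrow>
    'r poly poly poly \<Rightarrow> 's poly poly poly" where
  "map_poly3 h = map_poly (map_poly (map_poly h))"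


section \<open>An algebraic closure of the field of rational functions in three variables\<close>

type_synonym 'r ratfun3_closure = "'r poly poly poly fract alg_closure"

definition emb3 :: "'r::idom poly poly poly \<Rightarrow> 'r ratfun3_closure" where
  "emb3 q = to_ac (Fraction_Field.Fract q 1)"

definition base_emb :: "'r::idom \<Rightarrow> 'r ratfun3_closure" where
  "base_emb c = emb3 (const3 c)"

abbreviation gen_x :: "'r::idom ratfun3_closure" where "gen_x \<equiv> emb3 var_x"
abbreviation gen_y :: "'r::idom ratfun3_closure" where "gen_y \<equiv> emb3 var_y"
abbreviation gen_z :: "'r::idom ratfun3_closure" where "gen_z \<equiv> emb3 var_z"

text \<open>
  \<open>gen_fiber P u v\<close> is the polynomial \<open>P(t;u,v)\<close> in \<open>t\<close> for \<open>u\<close>, \<open>v\<close> in this closure. The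
  multiset \<open>proots (gen_fiber P u v)\<close> of its roots with multiplicities is the product of \<open>u\<close> and
  \<open>v\<close>.
\<close>

definition gen_fiber :: "'r::idom poly poly poly \<Rightarrow>
    'r ratfun3_closure \<Rightarrow> 'r ratfun3_closure \<Rightarrow> 'r ratfun3_closure poly" where
  "gen_fiber P u v = fiber base_emb P u v"


section \<open>Algebraic \<open>n\<close>-valued groups\<close>

text \<open>
  The notions are stated over an arbitrary integral domain \<open>R\<close> in place of the complex numbers,
  because the universal example lives over a polynomial ring. The coefficient \<open>F\<^sub>i(x,y)\<close> of
  \<open>P(z;x,y) = (\<Sum>k\<le>n. F\<^sub>n\<^sub>-\<^sub>k(x,y) z ^ k)\<close> is \<open>Fcoeff n P i\<close>.
\<close>

definition Fcoeff :: "nat \<Rightarrow> 'r::zero poly poly poly \<Rightarrow> nat \<Rightarrow> 'r poly poly" where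
  "Fcoeff n P i = Polynomial.coeff P (n - i)"

definition degrees_le :: "nat \<Rightarrow> 'r::zero poly poly poly \<Rightarrow> bool" where
  "degrees_le n P \<longleftrightarrow>
     Polynomial.degree P \<le> n \<and>
     (\<forall>k. Polynomial.degree (Polynomial.coeff P k) \<le> n) \<and>
     (\<forall>k j. Polynomial.degree (Polynomial.coeff (Polynomial.coeff P k) j) \<le> n)"

definition normalized :: "nat \<Rightarrow> 'r::comm_ring_1 poly poly poly \<Rightarrow> bool" where
  "normalized n P \<longleftrightarrow> eval2 (\<lambda>c. c) (Fcoeff n P 0) 0 0 = 1"

text \<open>
  The identity \<open>P(z;0,y) = F\<^sub>0(0,y) (z - y) ^ n\<close> is one of polynomials in \<open>z\<close> over \<open>R[y]\<close>, where
  \<open>[:0, 1:]\<close> is the variable \<open>y\<close>.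
\<close>

definition neutral_zero :: "nat \<Rightarrow> 'r::comm_ring_1 poly poly poly \<Rightarrow> bool" where
  "neutral_zero n P \<longleftrightarrow>
     fiber (\<lambda>c. [:c:]) P 0 [:0, 1:] =
     Polynomial.smult (eval2 (\<lambda>c. [:c:]) (Fcoeff n P 0) 0 [:0, 1:]) ([:- [:0, 1:], 1:] ^ n)"

text \<open>An algebraic map of the affine line to itself is given by a polynomial.\<close>

definition has_inverse :: "nat \<Rightarrow> 'r::comm_ring_1 poly poly poly \<Rightarrow> bool" where
  "has_inverse n P \<longleftrightarrow>
     (\<exists>\<iota> :: 'r poly. \<forall>x. eval2 (\<lambda>c. c) (Fcoeff n P n) x (poly \<iota> x) = 0 \<and>
                        eval2 (\<lambda>c. c) (Fcoeff n P n) (poly \<iota> x) x = 0)"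

definition associative_product :: "'r::idom poly poly poly \<Rightarrow> bool" where
  "associative_product P \<longleftrightarrow>
     (\<Prod>w\<in>#proots (gen_fiber P gen_x gen_y). \<Prod>v\<in>#proots (gen_fiber P w gen_z). [:- v, 1:]) =
     (\<Prod>w\<in>#proots (gen_fiber P gen_y gen_z). \<Prod>v\<in>#proots (gen_fiber P gen_x w). [:- v, 1:])"

definition nvalued_group_except_assoc :: "nat \<Rightarrow> 'r::comm_ring_1 poly poly poly \<Rightarrow> bool" where
  "nvalued_group_except_assoc n P \<longleftrightarrow>
     degrees_le n P \<and> normalized n P \<and> neutral_zero n P \<and> has_inverse n P"

definition nvalued_group :: "nat \<Rightarrow> 'r::idom poly poly poly \<Rightarrow> bool" where
  "nvalued_group n P \<longleftrightarrow> nvalued_group_except_assoc n P \<and> associative_product P"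

text \<open>
  Below, \<open>Q a b c\<close> is \<open>P(c; (-1) ^ n a, (-1) ^ n b)\<close>; it has to be invariant under all permutations
  of the three variables.
\<close>

definition symmetric_nvalued :: "nat \<Rightarrow> 'r::comm_ring_1 poly poly poly \<Rightarrow> bool" where
  "symmetric_nvalued n P \<longleftrightarrow>
     (let Q = (\<lambda>a b c. eval3 const3 P ((- 1) ^ n * a) ((- 1) ^ n * b) c)
      in \<forall>a b c. {#a, b, c#} = {#var_x, var_y, var_z#} \<longrightarrow> Q a b c = Q var_x var_y var_z)"

definition symmetric_nvalued_group :: "nat \<Rightarrow> 'r::idom poly poly poly \<Rightarrow> bool" where
  "symmetric_nvalued_group n P \<longleftrightarrow> nvalued_group n P \<and> symmetric_nvalued n P"


section \<open>The polynomial \<open>P\<^sub>2\<close> and the ideal of relations\<close>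

definition sigma1 :: "'r::comm_ring_1 poly poly poly" where
  "sigma1 = var_x + var_y + var_z"

definition sigma2 :: "'r::comm_ring_1 poly poly poly" where
  "sigma2 = var_x * var_y + var_y * var_z + var_x * var_z"

definition sigma3 :: "'r::comm_ring_1 poly poly poly" where
  "sigma3 = var_x * var_y * var_z"

definition P2 :: "'r::comm_ring_1 \<Rightarrow> 'r \<Rightarrow> 'r \<Rightarrow> 'r \<Rightarrow> 'r poly poly poly" where
  "P2 k2 k4 k6 k8 =
     sigma1\<^sup>2 - 4 * sigma2 + const3 k2 * sigma3 + const3 k8 * sigma3\<^sup>2
     + const3 k4 * sigma1 * sigma3 + const3 k6 * sigma2 * sigma3"

definition P2_univ :: "'r::comm_ring_1 \<Rightarrow> 'r \<Rightarrow> 'r \<Rightarrow> 'r poly poly poly" where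
  "P2_univ k2 k4 k6 =
     sigma1\<^sup>2 - 4 * sigma2 + 2 * const3 k2 * sigma3 + const3 (k4\<^sup>2 - k6 * k2) * sigma3\<^sup>2
     + 2 * const3 k4 * sigma1 * sigma3 + 2 * const3 k6 * sigma2 * sigma3"

text \<open>
  The ring \<open>\<complex>[k\<^sub>2,k\<^sub>4,k\<^sub>6,k\<^sub>8]\<close>, with innermost variable \<open>k\<^sub>2\<close> and outermost variable \<open>k\<^sub>8\<close>, and the
  ring \<open>\<complex>[k\<^sub>2,k\<^sub>4,k\<^sub>6]\<close>, whose variables are called \<open>U2\<close>, \<open>U4\<close>, \<open>U6\<close>.
\<close>

type_synonym param4 = "complex poly poly poly poly"
type_synonym param3 = "complex poly poly poly"

definition const4 :: "complex \<Rightarrow> param4" where "const4 c = [:[:[:[:c:]:]:]:]"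
definition K2 :: param4 where "K2 = [:[:[:[:0, 1:]:]:]:]"
definition K4 :: param4 where "K4 = [:[:[:0, 1:]:]:]"
definition K6 :: param4 where "K6 = [:[:0, 1:]:]"
definition K8 :: param4 where "K8 = [:0, 1:]"

definition U2 :: param3 where "U2 = [:[:[:0, 1:]:]:]"
definition U4 :: param3 where "U4 = [:[:0, 1:]:]"
definition U6 :: param3 where "U6 = [:0, 1:]"

abbreviation param4_ring :: "param4 ring" where "param4_ring \<equiv> ring_of_type_algebra"
abbreviation param3_ring :: "param3 ring" where "param3_ring \<equiv> ring_of_type_algebra"
abbreviation complex_ring :: "complex ring" where "complex_ring \<equiv> ring_of_type_algebra"

definition generic_P2 :: "param4 poly poly poly" where
  "generic_P2 = P2 K2 K4 K6 K8"

text \<open>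
  \<open>L(t) = a(x,y)\<^sup>2 P\<^sub>2(t;z\<^sub>1(x,y),z) P\<^sub>2(t;z\<^sub>2(x,y),z)\<close> and
  \<open>R(t) = a(y,z)\<^sup>2 P\<^sub>2(t;x,z\<^sub>1(y,z)) P\<^sub>2(t;x,z\<^sub>2(y,z))\<close>, where \<open>a = Fcoeff 2 generic_P2 0\<close> is the
  coefficient of \<open>z\<^sup>2\<close>.
\<close>

definition Lpoly :: "param4 ratfun3_closure poly" where
  "Lpoly = Polynomial.smult ((eval2 base_emb (Fcoeff 2 generic_P2 0) gen_x gen_y)\<^sup>2)
     (\<Prod>w\<in>#proots (gen_fiber generic_P2 gen_x gen_y). gen_fiber generic_P2 w gen_z)"

definition Rpoly :: "param4 ratfun3_closure poly" where
  "Rpoly = Polynomial.smult ((eval2 base_emb (Fcoeff 2 generic_P2 0) gen_y gen_z)\<^sup>2)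
     (\<Prod>w\<in>#proots (gen_fiber generic_P2 gen_y gen_z). gen_fiber generic_P2 gen_x w)"

text \<open>By Vieta's formulas the coefficients of \<open>L\<close> and \<open>R\<close> lie in the image of \<open>S[x,y,z]\<close>.\<close>

definition Lcoeff :: "nat \<Rightarrow> param4 poly poly poly" where
  "Lcoeff i = (THE q. emb3 q = Polynomial.coeff Lpoly i)"

definition Rcoeff :: "nat \<Rightarrow> param4 poly poly poly" where
  "Rcoeff i = (THE q. emb3 q = Polynomial.coeff Rpoly i)"

definition assoc_relations :: "param4 set" where
  "assoc_relations =
     {Polynomial.coeff (Polynomial.coeff (Polynomial.coeff
        (Lcoeff i * Rcoeff 4 - Lcoeff 4 * Rcoeff i) n) m) l | i l m n. i \<le> 3}"

definition assoc_ideal :: "param4 set" where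
  "assoc_ideal = genideal param4_ring assoc_relations"

abbreviation assoc_class :: "param4 \<Rightarrow> param4 set" where
  "assoc_class p \<equiv> assoc_ideal +>\<^bsub>param4_ring\<^esub> p"

text \<open>
  The \<open>\<complex>\<close>-algebra homomorphisms from \<open>S/I\<close> to \<open>\<complex>\<close>, where \<open>I\<close> is the ideal of relations. They are
  made extensional so that each of them is represented by a single function.
\<close>

definition quotient_points :: "(param4 set \<Rightarrow> complex) set" where
  "quotient_points =
     {\<phi> \<in> ring_hom (param4_ring Quot assoc_ideal) complex_ring.
        \<phi> \<in> extensional (carrier (param4_ring Quot assoc_ideal)) \<and>
        (\<forall>c. \<phi> (assoc_class (const4 c)) = c)}"

end

theory Submission
  imports Defs
begin

text \<open>
  By Vieta's formulas \<open>L(t)\<close> is the resultant in \<open>w\<close> of \<open>P\<^sub>2(w;x,y)\<close> and \<open>P\<^sub>2(w;z,t)\<close>, and \<open>R(t)\<close> is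
  that of \<open>P\<^sub>2(w;y,z)\<close> and \<open>P\<^sub>2(w;x,t)\<close>. Their difference is \<open>r D(t)\<close> with
  \<open>r = 4 k\<^sub>8 - k\<^sub>4\<^sup>2 + k\<^sub>6 k\<^sub>2\<close> and an explicit polynomial \<open>D\<close>, hence
  \<open>L\<^sub>i R\<^sub>4 - L\<^sub>4 R\<^sub>i = r (D\<^sub>i R\<^sub>4 - D\<^sub>4 R\<^sub>i)\<close> and all relations are multiples of \<open>r\<close>. Conversely
  \<open>L\<^sub>0 = R\<^sub>0 = P\<^sub>2(z;x,y)\<^sup>2\<close>, and the coefficient of \<open>x ^ 6 y z\<close> in \<open>L\<^sub>0 R\<^sub>4 - L\<^sub>4 R\<^sub>0\<close> is \<open>3 r\<close>. The same
  computation over any integral domain of characteristic zero shows that \<open>P\<^sub>2\<close> is associative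
  iff \<open>r = 0\<close>.
\<close>

section \<open>The resultant identity\<close>

text \<open>\<open>P\<^sub>2(w;u,v) = qa w\<^sup>2 + qb w + qc\<close>; since \<open>P\<^sub>2\<close> is symmetric, this also describes it as a
  polynomial in either of the other two arguments.\<close>

definition qa :: "'a::comm_ring_1 \<Rightarrow> 'a \<Rightarrow> 'a \<Rightarrow> 'a \<Rightarrow> 'a \<Rightarrow> 'a" where
  "qa k4 k6 k8 u v = 1 + k4 * (u * v) + k6 * (u * v * (u + v)) + k8 * (u * v)\<^sup>2"

definition qb :: "'a::comm_ring_1 \<Rightarrow> 'a \<Rightarrow> 'a \<Rightarrow> 'a \<Rightarrow> 'a \<Rightarrow> 'a" where
  "qb k2 k4 k6 u v = - 2 * (u + v) + k2 * (u * v) + k4 * (u * v * (u + v)) + k6 * (u * v)\<^sup>2"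

definition qc :: "'a::comm_ring_1 \<Rightarrow> 'a \<Rightarrow> 'a" where
  "qc u v = (u - v)\<^sup>2"

text \<open>The resultant of \<open>a w\<^sup>2 + b w + c\<close> and \<open>a' w\<^sup>2 + b' w + c'\<close> with respect to \<open>w\<close>.\<close>

definition quad_res :: "'a::comm_ring_1 \<Rightarrow> 'a \<Rightarrow> 'a \<Rightarrow> 'a \<Rightarrow> 'a \<Rightarrow> 'a \<Rightarrow> 'a" where
  "quad_res a b c a' b' c' = (a' * c - c' * a)\<^sup>2 - (a' * b - b' * a) * (b' * c - c' * b)"

text \<open>By the symmetry of \<open>P2\<close>, the values at \<open>x y z t\<close> and at
  \<open>y z x t\<close> are L(t) and R(t), so one formula serves both sides of
  associativity.\<close>

definition assoc_res :: "'a::comm_ring_1 \<Rightarrow> 'a \<Rightarrow> 'a \<Rightarrow> 'a \<Rightarrow> 'a \<Rightarrow> 'a \<Rightarrow> 'a \<Rightarrow> 'a \<Rightarrow> 'a" where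
  "assoc_res k2 k4 k6 k8 x y z t = quad_res
     (qa k4 k6 k8 x y) (qb k2 k4 k6 x y) (qc x y) (qa k4 k6 k8 z t) (qb k2 k4 k6 z t) (qc z t)"

text \<open>The difference of the two resultants changes sign under \<open>x \<leftrightarrow> z\<close> and under \<open>y \<leftrightarrow> t\<close>, so it is
  divisible by \<open>(x - z)(y - t)\<close>; the remaining factor only depends on the sums and products of
  the pairs \<open>x, z\<close> and \<open>y, t\<close>.\<close>

definition assoc_cofactor ::
  "'a::comm_ring_1 \<Rightarrow> 'a \<Rightarrow> 'a \<Rightarrow> 'a \<Rightarrow> 'a \<Rightarrow> 'a \<Rightarrow> 'a \<Rightarrow> 'a" where
  "assoc_cofactor k2 k4 k6 k8 U N W =
     3 * U\<^sup>2 + k2 * (U * N) + k4 * (U * W - 2 * N\<^sup>2) - 3 * k6 * (N * W) - k8 * W\<^sup>2"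

lemma assoc_res_diff:
  fixes x y z t k2 k4 k6 k8 :: "'a::idom"
  shows "assoc_res k2 k4 k6 k8 x y z t - assoc_res k2 k4 k6 k8 y z x t =
    (4 * k8 - k4\<^sup>2 + k6 * k2) * (x * y * z * t * (x - z) * (y - t) *
      assoc_cofactor k2 k4 k6 k8 (x + z - y - t) (y * t - x * z) (y * t * (x + z) - x * z * (y + t)))"
  unfolding assoc_res_def quad_res_def qa_def qb_def qc_def assoc_cofactor_def
  by Groebner_Basis.algebra  \<comment> \<open>HOL-Algebra shadows the method name.\<close>

section \<open>Homomorphisms of commutative rings\<close>

text \<open>Evaluations, fibres, changes of coefficients, \<open>emb3\<close> and maps out of the
  quotient, composed with \<open>assoc_class\<close>, all satisfy this predicate, so one set of
  rules computes the images of \<open>P2\<close> and of the resultants.\<close>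

locale ring_map =
  fixes h :: "'a::comm_ring_1 \<Rightarrow> 'b::comm_ring_1"
  assumes hom_add: "h (x + y) = h x + h y"
    and hom_mult: "h (x * y) = h x * h y"
    and hom_one: "h 1 = 1"
begin

lemma hom_zero: "h 0 = 0"
  using hom_add[of 0 0] by simp

lemma hom_uminus: "h (- x) = - h x"
  using hom_add[of x "- x"] by (simp add: hom_zero eq_neg_iff_add_eq_0 add.commute)

lemma hom_diff: "h (x - y) = h x - h y"
  using hom_add[of x "- y"] by (simp add: hom_uminus)

lemma hom_power: "h (x ^ n) = h x ^ n"
  by (induction n) (simp_all add: hom_one hom_mult)

lemma hom_of_nat: "h (of_nat n) = of_nat n"
  by (induction n) (simp_all add: hom_zero hom_one hom_add)

lemma hom_numeral: "h (numeral n) = numeral n"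
  using hom_of_nat[of "numeral n"] by simp

lemma hom_sum: "h (sum f A) = (\<Sum>x\<in>A. h (f x))"
  by (induction A rule: infinite_finite_induct) (simp_all add: hom_zero hom_add)

lemmas hom_simps = hom_zero hom_one hom_add hom_mult hom_uminus hom_diff hom_power hom_numeral

lemma map_poly_ring_map: "ring_map (map_poly h)"
proof
  fix p q :: "'a poly"
  show "map_poly h (p + q) = map_poly h p + map_poly h q"
    by (rule poly_eqI) (simp add: coeff_map_poly hom_simps)
  show "map_poly h (p * q) = map_poly h p * map_poly h q"
    by (rule poly_eqI) (simp add: coeff_map_poly coeff_mult hom_sum hom_simps)
  show "map_poly h 1 = 1"
    by (simp add: hom_simps map_poly_1)
qed

lemma map_poly_pCons: "map_poly h (pCons a p) = pCons (h a) (map_poly h p)"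
  by (rule poly_eqI) (simp add: coeff_map_poly hom_simps coeff_pCons split: nat.split)

end

section \<open>Evaluation homomorphisms and their values on generators\<close>

lemma ring_map_comp: "ring_map f \<Longrightarrow> ring_map g \<Longrightarrow> ring_map (\<lambda>x. g (f x))"
  by (simp add: ring_map_def)

lemma ring_map_ident: "ring_map (\<lambda>x. x)"
  by unfold_locales simp_all

lemma ring_map_const_poly: "ring_map (\<lambda>c. [:c:])"
  by unfold_locales simp_all

lemma ring_map_poly: "ring_map (\<lambda>p. poly p a)"
  by unfold_locales simp_all

lemma ring_map_const3: "ring_map const3"
  unfolding const3_def by unfold_locales (simp_all add: pCons_one)

lemma ring_map_eval2: "ring_map h \<Longrightarrow> ring_map (\<lambda>F. eval2 h F a b)"
  unfolding eval2_def
  by (intro ring_map_comp[OF _ ring_map_poly] ring_map.map_poly_ring_map)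

lemma ring_map_fiber: "ring_map h \<Longrightarrow> ring_map (\<lambda>P. fiber h P a b)"
  unfolding fiber_def by (intro ring_map.map_poly_ring_map ring_map_eval2)

lemma ring_map_eval3: "ring_map h \<Longrightarrow> ring_map (\<lambda>P. eval3 h P a b c)"
  unfolding eval3_def by (intro ring_map_comp[OF _ ring_map_poly] ring_map_fiber)

lemma eval2_pCons [simp]:
  "ring_map h \<Longrightarrow> eval2 h 0 a b = 0"
  "ring_map h \<Longrightarrow> eval2 h (pCons q F) a b = poly (map_poly h q) a + b * eval2 h F a b"
  using ring_map_comp[OF ring_map.map_poly_ring_map ring_map_poly, of h a]
  by (simp_all add: eval2_def ring_map.map_poly_pCons)

lemma fiber_pCons [simp]:
  "ring_map h \<Longrightarrow> fiber h 0 a b = 0"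
  "ring_map h \<Longrightarrow> fiber h (pCons F P) a b = pCons (eval2 h F a b) (fiber h P a b)"
  using ring_map_eval2[of h a b] by (simp_all add: fiber_def ring_map.map_poly_pCons)

lemma map_poly_hom_pCons [simp]:
  "ring_map h \<Longrightarrow> map_poly h (pCons q F) = pCons (h q) (map_poly h F)"
  by (rule ring_map.map_poly_pCons)

lemma fiber_gens [simp]:
  assumes "ring_map h"
  shows "fiber h (const3 c) a b = [:h c:]" "fiber h var_x a b = [:a:]"
    "fiber h var_y a b = [:b:]" "fiber h var_z a b = [:0, 1:]"
  using assms by (simp_all add: const3_def var_x_def var_y_def var_z_def
    ring_map.hom_zero ring_map.hom_one ring_map.hom_one[OF ring_map_eval2])

lemma eval3_gens [simp]:
  assumes "ring_map h"
  shows "eval3 h (const3 c) u v w = h c" "eval3 h var_x u v w = u"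
    "eval3 h var_y u v w = v" "eval3 h var_z u v w = w"
  using assms by (simp_all add: eval3_def)

lemma poly_hom_eqI:
  assumes f: "ring_map f" and g: "ring_map g"
    and const: "\<And>c. f [:c:] = g [:c:]" and var: "f [:0, 1:] = g [:0, 1:]"
  shows "f p = g p"
proof (induction p)
  case 0
  then show ?case by (simp add: ring_map.hom_zero[OF f] ring_map.hom_zero[OF g])
next
  case (pCons a p)
  have "pCons a p = [:a:] + [:0, 1:] * p" by simp
  then show ?case
    by (simp only: ring_map.hom_add[OF f] ring_map.hom_add[OF g] ring_map.hom_mult[OF f]
        ring_map.hom_mult[OF g] const var pCons.IH)
qed

text \<open>The variables are peeled off from the outside in: composition with
  \<open>\<lambda>c. [:c:]\<close> gives ring maps again, on polynomials in one variable
  fewer.\<close>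

lemma poly3_hom_eqI:
  assumes f: "ring_map f" and g: "ring_map g"
    and const: "\<And>c. f (const3 c) = g (const3 c)" and x: "f var_x = g var_x"
    and y: "f var_y = g var_y" and z: "f var_z = g var_z"
  shows "f p = g p"
proof (rule poly_hom_eqI[OF f g])
  note comp = ring_map_comp[OF ring_map_const_poly]
  show "f [:F:] = g [:F:]" for F
  proof (rule poly_hom_eqI[OF comp[OF f] comp[OF g]])
    show "f [:[:q:]:] = g [:[:q:]:]" for q
      by (rule poly_hom_eqI[OF comp[OF comp[OF f]] comp[OF comp[OF g]]])
        (use const x in \<open>simp_all add: const3_def var_x_def\<close>)
  qed (use y in \<open>simp add: var_y_def\<close>)
qed (use z in \<open>simp add: var_z_def\<close>)

lemma poly4_hom_eqI:
  assumes f: "ring_map f" and g: "ring_map g"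
    and const: "\<And>c. f (const4 c) = g (const4 c)" and "f K2 = g K2" "f K4 = g K4" "f K6 = g K6"
    and K8: "f K8 = g K8"
  shows "f p = g p"
proof (rule poly_hom_eqI[OF f g])
  note comp = ring_map_comp[OF ring_map_const_poly]
  show "f [:q:] = g [:q:]" for q
    by (rule poly3_hom_eqI[OF comp[OF f] comp[OF g]])
      (use assms in \<open>simp_all add: const3_def var_x_def var_y_def var_z_def const4_def
         K2_def K4_def K6_def\<close>)
qed (use K8 in \<open>simp add: K8_def\<close>)

section \<open>The polynomial \<open>P2\<close> under evaluation and change of coefficients\<close>

definition p2val :: "'a::comm_ring_1 \<Rightarrow> 'a \<Rightarrow> 'a \<Rightarrow> 'a \<Rightarrow> 'a \<Rightarrow> 'a \<Rightarrow> 'a \<Rightarrow> 'a" where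
  "p2val k2 k4 k6 k8 x y z =
     (x + y + z)\<^sup>2 - 4 * (x * y + y * z + x * z) + k2 * (x * y * z) + k8 * (x * y * z)\<^sup>2
     + k4 * (x + y + z) * (x * y * z) + k6 * (x * y + y * z + x * z) * (x * y * z)"

lemma p2val_quadratic:
  "p2val k2 k4 k6 k8 x y z = qa k4 k6 k8 x y * z\<^sup>2 + qb k2 k4 k6 x y * z + qc x y"
  unfolding p2val_def qa_def qb_def qc_def
  by (simp add: power2_eq_square algebra_simps)

text \<open>A ring map acts on a value of \<open>p2val\<close> through its arguments, so all
  evaluations, fibres and changes of coefficients of \<open>P2\<close> become instances of
  \<open>hom_p2val\<close>.\<close>

lemma P2_eq_p2val:
  "P2 k2 k4 k6 k8 =
     p2val (const3 k2) (const3 k4) (const3 k6) (const3 k8) var_x var_y var_z"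
  by (simp add: P2_def p2val_def sigma1_def sigma2_def sigma3_def)

context ring_map
begin

lemma hom_qa: "h (qa k4 k6 k8 u v) = qa (h k4) (h k6) (h k8) (h u) (h v)"
  by (simp add: qa_def hom_simps)

lemma hom_qb: "h (qb k2 k4 k6 u v) = qb (h k2) (h k4) (h k6) (h u) (h v)"
  by (simp add: qb_def hom_simps)

lemma hom_qc: "h (qc u v) = qc (h u) (h v)"
  by (simp add: qc_def hom_simps)

lemma hom_p2val:
  "h (p2val k2 k4 k6 k8 x y z) = p2val (h k2) (h k4) (h k6) (h k8) (h x) (h y) (h z)"
  by (simp add: p2val_def hom_simps)

lemma hom_assoc_res:
  "h (assoc_res k2 k4 k6 k8 x y z t) =
     assoc_res (h k2) (h k4) (h k6) (h k8) (h x) (h y) (h z) (h t)"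
  by (simp add: assoc_res_def quad_res_def hom_qa hom_qb hom_qc hom_simps)

end

text \<open>Left unexpanded, so that the symmetry of \<open>p2val\<close> can still be applied to
  fibres.\<close>

lemma fiber_P2_p2val:
  assumes h: "ring_map h"
  shows "fiber h (P2 k2 k4 k6 k8) u v =
      p2val [:h k2:] [:h k4:] [:h k6:] [:h k8:] [:u:] [:v:] [:0, 1:]"
  by (simp add: P2_eq_p2val ring_map.hom_p2val[OF ring_map_fiber[OF h]] h)

lemma fiber_P2:
  assumes h: "ring_map h"
  shows "fiber h (P2 k2 k4 k6 k8) u v =
    [:qc u v, qb (h k2) (h k4) (h k6) u v, qa (h k4) (h k6) (h k8) u v:]"
proof -
  have "fiber h (P2 k2 k4 k6 k8) u v =
      p2val [:h k2:] [:h k4:] [:h k6:] [:h k8:] [:u:] [:v:] [:0, 1:]"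
    by (rule fiber_P2_p2val[OF h])
  also have "\<dots> = [:qc u v, qb (h k2) (h k4) (h k6) u v, qa (h k4) (h k6) (h k8) u v:]"
    by (simp add: p2val_quadratic qa_def qb_def qc_def power2_eq_square numeral_poly one_pCons)
  finally show ?thesis .
qed

lemma eval3_P2:
  assumes h: "ring_map h"
  shows "eval3 h (P2 k2 k4 k6 k8) u v w = p2val (h k2) (h k4) (h k6) (h k8) u v w"
  by (simp add: P2_eq_p2val ring_map.hom_p2val[OF ring_map_eval3[OF h]] h)

lemma map_poly3_P2:
  assumes h: "ring_map h"
  shows "map_poly3 h (P2 k2 k4 k6 k8) = P2 (h k2) (h k4) (h k6) (h k8)"
proof -
  have "ring_map (map_poly3 h)"
    unfolding map_poly3_def by (intro ring_map.map_poly_ring_map h)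
  moreover have "map_poly3 h (const3 c) = const3 (h c)" for c
    using h by (simp add: map_poly3_def const3_def ring_map.map_poly_ring_map)
  moreover have "map_poly3 h var_x = var_x" "map_poly3 h var_y = var_y" "map_poly3 h var_z = var_z"
    using h by (simp_all add: map_poly3_def var_x_def var_y_def var_z_def
        ring_map.map_poly_ring_map ring_map.hom_zero ring_map.hom_one)
  ultimately show ?thesis
    by (simp add: P2_eq_p2val ring_map.hom_p2val)
qed

section \<open>Products over roots as resultants\<close>

lemma ring_map_emb3: "ring_map (emb3 :: 'r::idom poly poly poly \<Rightarrow> _)"
  by unfold_locales (simp_all add: emb3_def One_fract_def [symmetric] flip: to_ac_add to_ac_mult)

lemma emb3_eq_iff [simp]: "emb3 p = emb3 q \<longleftrightarrow> p = q"
  by (simp add: emb3_def eq_fract)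

lemma ring_map_base_emb: "ring_map (base_emb :: 'r::idom \<Rightarrow> _)"
  unfolding base_emb_def by (intro ring_map_comp[OF ring_map_const3 ring_map_emb3])

lemma proots_prod_linear: "proots (\<Prod>x\<in>#A. [:- x, 1:]) = (A :: 'a::idom multiset)"
proof (induction A)
  case (add x A)
  have "(\<Prod>x\<in>#A. [:- x, 1:]) \<noteq> 0" by (auto simp: prod_mset_zero_iff)
  then show ?case using add by (simp add: proots_mult del: mult_pCons_left)
qed simp

lemma proots_factorization:
  fixes p :: "'a::alg_closed_field poly"
  assumes "p \<noteq> 0"
  shows "p = Polynomial.smult (Polynomial.lead_coeff p) (\<Prod>x\<in>#proots p. [:- x, 1:])"
    and "size (proots p) = Polynomial.degree p"
proof -
  obtain A where A: "size A = Polynomial.degree p"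
      "p = Polynomial.smult (Polynomial.lead_coeff p) (\<Prod>x\<in>#A. [:- x, 1:])"
    using alg_closed_imp_factorization[OF assms] by blast
  have "proots p = proots (\<Prod>x\<in>#A. [:- x, 1:])"
    using assms by (subst A(2)) simp
  also have "\<dots> = A"
    by (rule proots_prod_linear)
  finally show "p = Polynomial.smult (Polynomial.lead_coeff p) (\<Prod>x\<in>#proots p. [:- x, 1:])"
    "size (proots p) = Polynomial.degree p"
    using A by simp_all
qed

text \<open>Links the product of fibres that defines L(t) and R(t) with the product of linear
  factors in the associativity axiom, which is its monic normalization.\<close>

lemma prod_mset_proots_factorization:
  fixes f :: "'b \<Rightarrow> 'a::alg_closed_field poly"
  assumes "\<And>w. w \<in># W \<Longrightarrow> f w \<noteq> 0"
  shows "(\<Prod>w\<in>#W. f w) = Polynomial.smult (Polynomial.lead_coeff (\<Prod>w\<in>#W. f w))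
    (\<Prod>w\<in>#W. \<Prod>x\<in>#proots (f w). [:- x, 1:])"
  using assms
proof (induction W)
  case (add w W)
  define F G where "F = (\<Prod>w\<in>#W. f w)" and "G = (\<Prod>w\<in>#W. \<Prod>x\<in>#proots (f w). [:- x, 1:])"
  have "f w = Polynomial.smult (Polynomial.lead_coeff (f w)) (\<Prod>x\<in>#proots (f w). [:- x, 1:])"
    using add.prems by (intro proots_factorization) simp
  moreover have "F = Polynomial.smult (Polynomial.lead_coeff F) G"
    using add by (simp add: F_def G_def)
  ultimately have "f w * F = Polynomial.smult (Polynomial.lead_coeff (f w))
      (\<Prod>x\<in>#proots (f w). [:- x, 1:]) * Polynomial.smult (Polynomial.lead_coeff F) G"
    by (rule arg_cong2)
  also have "\<dots> = Polynomial.smult (Polynomial.lead_coeff (f w * F))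
      ((\<Prod>x\<in>#proots (f w). [:- x, 1:]) * G)"
    by (simp add: lead_coeff_mult mult.commute)
  finally show ?case by (simp add: F_def G_def)
qed simp

lemma proots_quadratic:
  fixes a b c :: "'a::alg_closed_field"
  assumes "a \<noteq> 0"
  obtains w1 w2 where "proots [:c, b, a:] = {#w1, w2#}" "b = - a * (w1 + w2)" "c = a * w1 * w2"
proof -
  have "[:c, b, a:] \<noteq> 0" using assms by simp
  note f = proots_factorization[OF this]
  from f(2) have "size (proots [:c, b, a:]) = 2" using assms by simp
  then obtain w1 N where "proots [:c, b, a:] = add_mset w1 N" "size N = 1"
    by (metis size_eq_Suc_imp_eq_union nat.inject numeral_2_eq_2 One_nat_def size_add_mset)
  then obtain w2 where w: "proots [:c, b, a:] = {#w1, w2#}"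
    using size_1_singleton_mset by metis
  from f(1) have "[:c, b, a:] = [:a * w1 * w2, - a * (w1 + w2), a:]"
    using assms by (simp add: w algebra_simps)
  then show thesis using w that by simp
qed

text \<open>Vieta's formulas express \<open>b\<close> and \<open>c\<close> through \<open>a\<close>
  and the two roots, and then the claim is a polynomial identity. \<open>A\<close>, \<open>B\<close>
  and \<open>C\<close> will be polynomials in t, hence the roots enter as constant
  polynomials.\<close>

lemma prod_proots_quadratic:
  fixes a b c :: "'a::alg_closed_field"
  assumes "a \<noteq> 0"
  shows "Polynomial.smult (a\<^sup>2) (\<Prod>w\<in>#proots [:c, b, a:]. A * [:w:]\<^sup>2 + B * [:w:] + C) =
    quad_res [:a:] [:b:] [:c:] A B C"
proof -
  obtain w1 w2 where w: "proots [:c, b, a:] = {#w1, w2#}" "b = - a * (w1 + w2)" "c = a * w1 * w2"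
    using proots_quadratic[OF assms] by metis
  define a' u v where "a' = [:a:]" and "u = [:w1:]" and "v = [:w2:]"
  have "[:b:] = - a' * (u + v)" "[:c:] = a' * u * v" "[:a\<^sup>2:] = a'\<^sup>2"
    by (simp_all add: a'_def u_def v_def w power2_eq_square algebra_simps)
  moreover have "a'\<^sup>2 * ((A * u\<^sup>2 + B * u + C) * (A * v\<^sup>2 + B * v + C)) =
      quad_res a' (- a' * (u + v)) (a' * u * v) A B C"
    unfolding quad_res_def by (simp add: power2_eq_square algebra_simps)
  moreover have "Polynomial.smult (a\<^sup>2) p = [:a\<^sup>2:] * p" for p by simp
  ultimately show ?thesis
    unfolding w(1) by (simp only: image_mset_add_mset image_mset_empty prod_mset.add_mset
        prod_mset.empty mult_1_right flip: a'_def u_def v_def)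
qed

lemma p2val_rotate: "p2val k2 k4 k6 k8 x y z = p2val k2 k4 k6 k8 y z x"
  and p2val_swap: "p2val k2 k4 k6 k8 x y z = p2val k2 k4 k6 k8 y x z"
  by (simp_all add: p2val_def ac_simps)

lemma gen_fiber_P2_commute: "gen_fiber (P2 k2 k4 k6 k8) u v = gen_fiber (P2 k2 k4 k6 k8) v u"
  using p2val_swap by (metis gen_fiber_def fiber_P2_p2val ring_map_base_emb)

definition assoc_poly ::
  "'a::comm_ring_1 \<Rightarrow> 'a \<Rightarrow> 'a \<Rightarrow> 'a \<Rightarrow> 'a \<Rightarrow> 'a \<Rightarrow> 'a \<Rightarrow> 'a poly" where
  "assoc_poly k2 k4 k6 k8 x y z =
     assoc_res [:k2:] [:k4:] [:k6:] [:k8:] [:x:] [:y:] [:z:] [:0, 1:]"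

lemma (in ring_map) map_poly_assoc_poly:
  "map_poly h (assoc_poly k2 k4 k6 k8 x y z) =
     assoc_poly (h k2) (h k4) (h k6) (h k8) (h x) (h y) (h z)"
  by (simp add: assoc_poly_def ring_map.hom_assoc_res[OF map_poly_ring_map] map_poly_pCons
      hom_simps)

lemma prod_gen_fiber_P2:
  assumes "qa (base_emb k4) (base_emb k6) (base_emb k8) u v \<noteq> 0"
  shows "Polynomial.smult ((qa (base_emb k4) (base_emb k6) (base_emb k8) u v)\<^sup>2)
      (\<Prod>w\<in>#proots (gen_fiber (P2 k2 k4 k6 k8) u v). gen_fiber (P2 k2 k4 k6 k8) w s) =
    assoc_poly (base_emb k2) (base_emb k4) (base_emb k6) (base_emb k8) u v s"
proof -
  \<comment> \<open>The fibre is a polynomial in t; rotating the arguments of \<open>p2val\<close>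
    rereads it as a quadratic in the root \<open>w\<close>, with coefficients that depend on
    \<open>s\<close> and t.\<close>
  have "gen_fiber (P2 k2 k4 k6 k8) w s =
      qa [:base_emb k4:] [:base_emb k6:] [:base_emb k8:] [:s:] [:0, 1:] * [:w:]\<^sup>2
      + qb [:base_emb k2:] [:base_emb k4:] [:base_emb k6:] [:s:] [:0, 1:] * [:w:]
      + qc [:s:] [:0, 1:]" for w
    unfolding gen_fiber_def fiber_P2_p2val[OF ring_map_base_emb]
    by (subst p2val_rotate) (rule p2val_quadratic)
  then show ?thesis
    by (simp only: prod_proots_quadratic[OF assms] gen_fiber_def[of _ u v]
      fiber_P2[OF ring_map_base_emb] assoc_poly_def assoc_res_def)
      (simp only: ring_map.hom_qa[OF ring_map_const_poly] ring_map.hom_qb[OF ring_map_const_poly]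
      ring_map.hom_qc[OF ring_map_const_poly])
qed

context
  fixes k2 k4 k6 k8 :: "'r::idom" and u v s :: "'r poly poly poly"
  assumes zero: "eval3 (\<lambda>c. c) u 0 0 0 = 0" "eval3 (\<lambda>c. c) v 0 0 0 = 0" "eval3 (\<lambda>c. c) s 0 0 0 = 0"
begin

interpretation e0: ring_map "\<lambda>p. eval3 (\<lambda>c. c) p 0 0 (0::'r)"
  by (intro ring_map_eval3 ring_map_ident)

interpretation e: ring_map "emb3 :: 'r poly poly poly \<Rightarrow> _"
  by (rule ring_map_emb3)

text \<open>At the origin \<open>u\<close> and \<open>v\<close> vanish and \<open>qa\<close> takes
  the value 1. The assumptions of the context hold for each of the three variables, so both L and R
  are covered.\<close>

lemma qa_emb3_nonzero: "qa (base_emb k4) (base_emb k6) (base_emb k8) (emb3 u) (emb3 v) \<noteq> 0"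
proof -
  have "eval3 (\<lambda>c. c) (qa (const3 k4) (const3 k6) (const3 k8) u v) 0 0 0 = 1"
    by (simp add: e0.hom_qa zero) (simp add: qa_def)
  then have "qa (const3 k4) (const3 k6) (const3 k8) u v \<noteq> 0"
    using e0.hom_zero by auto
  then have "emb3 (qa (const3 k4) (const3 k6) (const3 k8) u v) \<noteq> 0"
    using emb3_eq_iff e.hom_zero by metis
  then show ?thesis by (simp add: e.hom_qa base_emb_def)
qed

text \<open>At the origin the two quadratics become w^2 and (w - t)^2, whose resultant t^4 is
  nonzero.\<close>

lemma assoc_poly_nonzero: "assoc_poly (const3 k2) (const3 k4) (const3 k6) (const3 k8) u v s \<noteq> 0"
proof
  assume "assoc_poly (const3 k2) (const3 k4) (const3 k6) (const3 k8) u v s = 0"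
  then have "map_poly (\<lambda>p. eval3 (\<lambda>c. c) p 0 0 0)
      (assoc_poly (const3 k2) (const3 k4) (const3 k6) (const3 k8) u v s) = 0" by simp
  then have "assoc_poly k2 k4 k6 k8 0 0 0 = 0"
    by (simp add: e0.map_poly_assoc_poly zero ring_map_ident)
  then show False
    by (simp add: assoc_poly_def assoc_res_def quad_res_def qa_def qb_def qc_def)
qed

text \<open>The product over the roots, formed in the closure, descends to a polynomial in t with
  coefficients in x, y, z over the base ring.\<close>

lemma assoc_poly_eq_prod:
  "Polynomial.smult ((qa (base_emb k4) (base_emb k6) (base_emb k8) (emb3 u) (emb3 v))\<^sup>2)
    (\<Prod>w\<in>#proots (gen_fiber (P2 k2 k4 k6 k8) (emb3 u) (emb3 v)).
       gen_fiber (P2 k2 k4 k6 k8) w (emb3 s)) =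
   map_poly emb3 (assoc_poly (const3 k2) (const3 k4) (const3 k6) (const3 k8) u v s)"
  using prod_gen_fiber_P2[OF qa_emb3_nonzero]
  by (simp add: e.map_poly_assoc_poly base_emb_def)

text \<open>The product on the right is monic, so associativity compares the two resultants up to
  their leading coefficients. Working with \<open>lead_coeff\<close> instead of the coefficient of
  t^4 avoids computing a degree.\<close>

lemma assoc_poly_eq_smult_prod:
  "map_poly emb3 (assoc_poly (const3 k2) (const3 k4) (const3 k6) (const3 k8) u v s) =
   Polynomial.smult (Polynomial.lead_coeff
     (map_poly emb3 (assoc_poly (const3 k2) (const3 k4) (const3 k6) (const3 k8) u v s)))
    (\<Prod>w\<in>#proots (gen_fiber (P2 k2 k4 k6 k8) (emb3 u) (emb3 v)).
      \<Prod>x\<in>#proots (gen_fiber (P2 k2 k4 k6 k8) w (emb3 s)). [:- x, 1:])"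
    (is "?L = _")
proof -
  let ?f = "\<lambda>w. gen_fiber (P2 k2 k4 k6 k8) w (emb3 s)"
  define W where "W = proots (gen_fiber (P2 k2 k4 k6 k8) (emb3 u) (emb3 v))"
  define q where "q = (qa (base_emb k4) (base_emb k6) (base_emb k8) (emb3 u) (emb3 v))\<^sup>2"
  have L: "?L = Polynomial.smult q (\<Prod>w\<in>#W. ?f w)"
    using assoc_poly_eq_prod by (simp add: W_def q_def)
  have "?L \<noteq> 0"
  proof
    assume "?L = 0"
    then have "emb3 (Polynomial.coeff
        (assoc_poly (const3 k2) (const3 k4) (const3 k6) (const3 k8) u v s) n) = emb3 0" for n
      by (metis coeff_map_poly coeff_0 e.hom_zero)
    then show False
      using assoc_poly_nonzero by (simp only: emb3_eq_iff poly_eq_iff coeff_0 simp_thms)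
  qed
  \<comment> \<open>A single zero fibre would make the whole product, and with it the resultant,
    vanish.\<close>
  then have nz: "?f w \<noteq> 0" if "w \<in># W" for w
    using that unfolding L by (auto simp: prod_mset_zero_iff)
  have "?L = Polynomial.smult (q * Polynomial.lead_coeff (\<Prod>w\<in>#W. ?f w))
      (\<Prod>w\<in>#W. \<Prod>x\<in>#proots (?f w). [:- x, 1:])"
    by (rule trans[OF L arg_cong[where f = "Polynomial.smult q",
      OF prod_mset_proots_factorization[OF nz], unfolded smult_smult]])
  also have "q * Polynomial.lead_coeff (\<Prod>w\<in>#W. ?f w) = Polynomial.lead_coeff ?L"
    unfolding L by (rule lead_coeff_smult[symmetric])
  finally show ?thesis unfolding W_def .
qed

end

section \<open>The associativity relations\<close>

text \<open>The factor D(t) that accompanies the relation in \<open>assoc_res_diff\<close>.\<close>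

definition cofactor_poly ::
  "'a::comm_ring_1 \<Rightarrow> 'a \<Rightarrow> 'a \<Rightarrow> 'a \<Rightarrow> 'a \<Rightarrow> 'a \<Rightarrow> 'a \<Rightarrow> 'a poly" where
  "cofactor_poly k2 k4 k6 k8 x y z =
     [:x:] * [:y:] * [:z:] * [:0, 1:] * ([:x:] - [:z:]) * ([:y:] - [:0, 1:]) *
     assoc_cofactor [:k2:] [:k4:] [:k6:] [:k8:] ([:x:] + [:z:] - [:y:] - [:0, 1:])
       ([:y:] * [:0, 1:] - [:x:] * [:z:])
       ([:y:] * [:0, 1:] * ([:x:] + [:z:]) - [:x:] * [:z:] * ([:y:] + [:0, 1:]))"

lemma assoc_poly_diff:
  "assoc_poly k2 k4 k6 k8 x y z - assoc_poly k2 k4 k6 k8 y z x =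
     [:4 * k8 - k4\<^sup>2 + k6 * k2:] * cofactor_poly k2 k4 k6 k8 x y (z :: 'a::idom)"
proof -
  have "[:4 * k8 - k4\<^sup>2 + k6 * k2:] = 4 * [:k8:] - [:k4:]\<^sup>2 + [:k6:] * [:k2:]"
    by (simp add: power2_eq_square numeral_poly)
  then show ?thesis
    by (simp only: assoc_poly_def cofactor_poly_def assoc_res_diff)
qed

text \<open>D(t) is \<open>x * y * z * (x - z)\<close> times t (y - t) times a quadratic in t, whose
  coefficient of t^2 is picked up with the sign of -t in y - t.\<close>

lemma coeff_cofactor_poly_4:
  "Polynomial.coeff (cofactor_poly k2 k4 k6 k8 x y z) 4 = x * y * z * (z - x) *
     (3 - k2 * y - k4 * (y * (x + z) - x * z + 2 * y\<^sup>2) - 3 * k6 * y * (y * (x + z) - x * z)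
        - k8 * (y * (x + z) - x * z)\<^sup>2)"
proof -
  let ?c = "y * (x + z) - x * z"
  \<comment> \<open>The three arguments of \<open>assoc_cofactor\<close> are linear in t, so its
    value is quadratic, with the coefficients \<open>m0\<close>, \<open>m1\<close>,
    \<open>m2\<close> below; only \<open>m2\<close> reaches t^4.\<close>
  have lin: "[:x:] + [:z:] - [:y:] - [:0, 1:] = [:x + z - y, - 1:]"
    "[:y:] * [:0, 1:] - [:x:] * [:z:] = [:- (x * z), y:]"
    "[:y:] * [:0, 1:] * ([:x:] + [:z:]) - [:x:] * [:z:] * ([:y:] + [:0, 1:]) =
       [:- (x * z * y), ?c:]"
    by (simp_all add: algebra_simps)
  define m0 where "m0 = 3 * (x + z - y)\<^sup>2 - k2 * ((x + z - y) * (x * z))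
    - k4 * ((x + z - y) * (x * z * y) + 2 * (x * z)\<^sup>2) - 3 * k6 * (x * z * (x * z * y))
    - k8 * (x * z * y)\<^sup>2"
  define m1 where "m1 = - 6 * (x + z - y) + k2 * ((x + z - y) * y + x * z)
    + k4 * ((x + z - y) * ?c + x * z * y + 4 * (x * z * y))
    - 3 * k6 * (- (x * z * ?c) - y * (x * z * y)) + 2 * k8 * (x * z * y * ?c)"
  define m2 where "m2 = 3 - k2 * y - k4 * (?c + 2 * y\<^sup>2) - 3 * k6 * y * ?c - k8 * ?c\<^sup>2"
  have "assoc_cofactor [:k2:] [:k4:] [:k6:] [:k8:] [:x + z - y, - 1:] [:- (x * z), y:]
      [:- (x * z * y), ?c:] = [:m0, m1, m2:]"
    unfolding assoc_cofactor_def m0_def m1_def m2_def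
    by (simp add: power2_eq_square numeral_poly) (simp add: algebra_simps)
  then have "cofactor_poly k2 k4 k6 k8 x y z =
      [:x * y * z * (x - z):] * ([:0, 1:] * [:y, - 1:] * [:m0, m1, m2:])"
    unfolding cofactor_poly_def lin by (simp add: algebra_simps)
  also have "Polynomial.coeff \<dots> 4 = x * y * z * (z - x) * m2"
    by (simp add: coeff_pCons eval_nat_numeral algebra_simps)
  finally show ?thesis unfolding m2_def .
qed

lemma coeff_cofactor_poly_0: "Polynomial.coeff (cofactor_poly k2 k4 k6 k8 x y z) 0 = 0"
  by (simp add: cofactor_poly_def coeff_mult_0)

text \<open>At t = 0 the second quadratic is (w - z)^2 with the double root z, so the resultant is
  the square of the first quadratic at z.\<close>

lemma coeff_assoc_poly_0:
  "Polynomial.coeff (assoc_poly k2 k4 k6 k8 x y z) 0 = (p2val k2 k4 k6 k8 x y z)\<^sup>2"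
proof -
  have "Polynomial.coeff (assoc_poly k2 k4 k6 k8 x y z) 0 = assoc_res k2 k4 k6 k8 x y z 0"
    unfolding assoc_poly_def poly_0_coeff_0 [symmetric]
    by (simp add: ring_map.hom_assoc_res[OF ring_map_poly])
  also have "\<dots> = (p2val k2 k4 k6 k8 x y z)\<^sup>2"
    unfolding p2val_quadratic assoc_res_def quad_res_def
    by (simp add: qa_def [of _ _ _ z 0] qb_def [of _ _ _ z 0] qc_def [of z 0])
       (simp add: power2_eq_square algebra_simps)
  finally show ?thesis .
qed

definition left_poly :: "'r::comm_ring_1 \<Rightarrow> 'r \<Rightarrow> 'r \<Rightarrow> 'r \<Rightarrow> 'r poly poly poly poly" where
  "left_poly k2 k4 k6 k8 =
     assoc_poly (const3 k2) (const3 k4) (const3 k6) (const3 k8) var_x var_y var_z"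

definition right_poly :: "'r::comm_ring_1 \<Rightarrow> 'r \<Rightarrow> 'r \<Rightarrow> 'r \<Rightarrow> 'r poly poly poly poly" where
  "right_poly k2 k4 k6 k8 =
     assoc_poly (const3 k2) (const3 k4) (const3 k6) (const3 k8) var_y var_z var_x"

definition gen_cofactor :: "'r::comm_ring_1 \<Rightarrow> 'r \<Rightarrow> 'r \<Rightarrow> 'r \<Rightarrow> 'r poly poly poly poly" where
  "gen_cofactor k2 k4 k6 k8 =
     cofactor_poly (const3 k2) (const3 k4) (const3 k6) (const3 k8) var_x var_y var_z"

definition assoc_rel :: "'r::comm_ring_1 \<Rightarrow> 'r \<Rightarrow> 'r \<Rightarrow> 'r \<Rightarrow> 'r" where
  "assoc_rel k2 k4 k6 k8 = 4 * k8 - k4\<^sup>2 + k6 * k2"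

lemma (in ring_map) hom_assoc_rel: "h (assoc_rel k2 k4 k6 k8) = assoc_rel (h k2) (h k4) (h k6) (h k8)"
  by (simp add: assoc_rel_def hom_simps)

lemma left_right_diff:
  "left_poly k2 k4 k6 k8 =
     right_poly k2 k4 k6 k8 + [:const3 (assoc_rel k2 k4 k6 k8):] * gen_cofactor k2 k4 k6 (k8 :: 'r::idom)"
  unfolding left_poly_def right_poly_def gen_cofactor_def ring_map.hom_assoc_rel[OF ring_map_const3]
  unfolding assoc_rel_def
  using assoc_poly_diff [of "const3 k2" "const3 k4" "const3 k6" "const3 k8" var_x var_y var_z]
  by (simp only: diff_eq_eq add.commute)

lemma assoc_minor_eq:
  "Polynomial.coeff (left_poly k2 k4 k6 k8) i * Polynomial.coeff (right_poly k2 k4 k6 k8) j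
   - Polynomial.coeff (left_poly k2 k4 k6 k8) j * Polynomial.coeff (right_poly k2 k4 k6 k8) i =
   const3 (assoc_rel k2 k4 k6 (k8 :: 'r::idom)) *
     (Polynomial.coeff (gen_cofactor k2 k4 k6 k8) i * Polynomial.coeff (right_poly k2 k4 k6 k8) j
      - Polynomial.coeff (gen_cofactor k2 k4 k6 k8) j * Polynomial.coeff (right_poly k2 k4 k6 k8) i)"
  by (simp add: left_right_diff algebra_simps)

lemma coeff_const3_mult:
  "Polynomial.coeff (Polynomial.coeff (Polynomial.coeff (const3 c * p) n) m) l =
     c * Polynomial.coeff (Polynomial.coeff (Polynomial.coeff p n) m) l"
  by (simp add: const3_def)

text \<open>Since D has no constant term and R_0 is the square of \<open>P2\<close>, the minor is
  the relation times xyz times \<open>H\<close>. The coefficient of x^6 y z thus comes from x^5 in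
  \<open>H\<close> at y = z = 0, where \<open>?c\<close> vanishes, \<open>P2\<close> becomes x^2 and
  \<open>H\<close> becomes 3 x^5.\<close>

lemma coeff_assoc_minor:
  "Polynomial.coeff (Polynomial.coeff (Polynomial.coeff
     (Polynomial.coeff (left_poly k2 k4 k6 k8) 0 * Polynomial.coeff (right_poly k2 k4 k6 k8) 4
      - Polynomial.coeff (left_poly k2 k4 k6 k8) 4 * Polynomial.coeff (right_poly k2 k4 k6 k8) 0)
     1) 1) 6 = 3 * assoc_rel k2 k4 k6 (k8 :: 'r::idom)"
proof -
  let ?c = "var_y * (var_x + var_z) - var_x * var_z :: 'r poly poly poly"
  define H :: "'r poly poly poly" where "H = (var_x - var_z) *
      (3 - const3 k2 * var_y - const3 k4 * (?c + 2 * var_y\<^sup>2) - 3 * const3 k6 * var_y * ?c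
        - const3 k8 * ?c\<^sup>2) * (P2 k2 k4 k6 k8)\<^sup>2"
  have "Polynomial.coeff (right_poly k2 k4 k6 k8) 0 = (P2 k2 k4 k6 k8)\<^sup>2"
    unfolding right_poly_def coeff_assoc_poly_0 P2_eq_p2val by (metis p2val_rotate)
  then have "Polynomial.coeff (left_poly k2 k4 k6 k8) 0 * Polynomial.coeff (right_poly k2 k4 k6 k8) 4
      - Polynomial.coeff (left_poly k2 k4 k6 k8) 4 * Polynomial.coeff (right_poly k2 k4 k6 k8) 0
      = const3 (assoc_rel k2 k4 k6 k8) * (var_z * (var_y * (var_x * H)))"
    unfolding assoc_minor_eq gen_cofactor_def coeff_cofactor_poly_0 coeff_cofactor_poly_4 H_def
    by (simp add: algebra_simps)
  moreover have "Polynomial.coeff (Polynomial.coeff (Polynomial.coeff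
      (var_z * (var_y * (var_x * H))) 1) 1) 6 = 3"
  proof -
    have "Polynomial.coeff (Polynomial.coeff (Polynomial.coeff
        (var_z * (var_y * (var_x * H))) 1) 1) 6 =
        Polynomial.coeff (Polynomial.coeff (Polynomial.coeff H 0) 0) 5"
      by (simp add: var_x_def var_y_def var_z_def coeff_pCons eval_nat_numeral)
    also have "Polynomial.coeff (Polynomial.coeff H 0) 0 = poly (poly H 0) 0"
      by (simp add: poly_0_coeff_0)
    also have "\<dots> = [:0, 1:] * 3 * ([:0, 1:]\<^sup>2)\<^sup>2"
      by (simp add: H_def P2_eq_p2val p2val_def var_x_def var_y_def var_z_def const3_def)
    also have "Polynomial.coeff \<dots> 5 = 3"
      by (simp add: power2_eq_square coeff_pCons eval_nat_numeral numeral_poly)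
    finally show ?thesis .
  qed
  ultimately show ?thesis by (simp only: coeff_const3_mult mult.commute)
qed

section \<open>Associativity of \<open>P2\<close> and the coefficients of L and R\<close>

lemma gens_at_0:
  "eval3 (\<lambda>c. c) var_x 0 0 0 = (0::'r::comm_ring_1)" "eval3 (\<lambda>c. c) var_y 0 0 0 = (0::'r)"
  "eval3 (\<lambda>c. c) var_z 0 0 0 = (0::'r)"
  by (simp_all add: ring_map_ident)

text \<open>The two products of linear factors are L and R divided by their leading coefficients. If
  they agree, all 2 by 2 minors of the two coefficient sequences vanish, among them the one
  containing three times the relation, and 3 cancels in characteristic zero. If the relation holds,
  L and R coincide.\<close>

lemma associative_product_P2_iff:
  fixes k2 k4 k6 k8 :: "'r::{idom, ring_char_0}"
  shows "associative_product (P2 k2 k4 k6 k8) \<longleftrightarrow> assoc_rel k2 k4 k6 k8 = 0"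
proof -
  let ?P = "P2 k2 k4 k6 k8"
  define L R where "L = map_poly emb3 (left_poly k2 k4 k6 k8)"
    and "R = map_poly emb3 (right_poly k2 k4 k6 k8)"
  define QL where "QL = (\<Prod>w\<in>#proots (gen_fiber ?P gen_x gen_y).
    \<Prod>v\<in>#proots (gen_fiber ?P w gen_z). [:- v, 1:])"
  define QR where "QR = (\<Prod>w\<in>#proots (gen_fiber ?P gen_y gen_z).
    \<Prod>v\<in>#proots (gen_fiber ?P gen_x w). [:- v, 1:])"
  have assoc: "associative_product ?P \<longleftrightarrow> QL = QR"
    by (simp add: associative_product_def QL_def QR_def)
  have L: "L = Polynomial.smult (Polynomial.lead_coeff L) QL"
    unfolding L_def QL_def left_poly_def by (rule assoc_poly_eq_smult_prod) (rule gens_at_0)+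
  \<comment> \<open>Commutativity moves the root \<open>w\<close> into the first slot, so that the
    lemma used for L applies with the variables rotated.\<close>
  have R: "R = Polynomial.smult (Polynomial.lead_coeff R) QR"
    unfolding R_def QR_def right_poly_def gen_fiber_P2_commute[of _ _ _ _ gen_x]
    by (rule assoc_poly_eq_smult_prod) (rule gens_at_0)+
  have coeffs: "Polynomial.coeff L i = emb3 (Polynomial.coeff (left_poly k2 k4 k6 k8) i)"
    "Polynomial.coeff R i = emb3 (Polynomial.coeff (right_poly k2 k4 k6 k8) i)" for i
    by (simp_all add: L_def R_def coeff_map_poly ring_map.hom_zero[OF ring_map_emb3])
  show ?thesis
  proof
    assume "associative_product ?P"
    then have eq: "QL = QR" using assoc by simp
    have "Polynomial.coeff L i * Polynomial.coeff R j = Polynomial.coeff L j * Polynomial.coeff R i"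
      for i j
      by (subst (1 2) L, subst (1 2) R) (simp add: eq)
    then have "Polynomial.coeff (left_poly k2 k4 k6 k8) 0 * Polynomial.coeff (right_poly k2 k4 k6 k8) 4
      - Polynomial.coeff (left_poly k2 k4 k6 k8) 4 * Polynomial.coeff (right_poly k2 k4 k6 k8) 0 = 0"
      by (simp add: coeffs flip: ring_map.hom_mult[OF ring_map_emb3])
    then have "3 * assoc_rel k2 k4 k6 k8 = 0"
      using coeff_assoc_minor[of k2 k4 k6 k8] by simp
    then show "assoc_rel k2 k4 k6 k8 = 0" by simp
  next
    assume "assoc_rel k2 k4 k6 k8 = 0"
    then have "left_poly k2 k4 k6 k8 = right_poly k2 k4 k6 k8"
      using left_right_diff[of k2 k4 k6 k8] by (simp add: const3_def)
    then have "L = R" by (simp add: L_def R_def)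
    moreover have "Polynomial.lead_coeff L \<noteq> 0"
    proof -
      have "left_poly k2 k4 k6 k8 \<noteq> 0"
        unfolding left_poly_def by (rule assoc_poly_nonzero) (rule gens_at_0)+
      then obtain i where "Polynomial.coeff (left_poly k2 k4 k6 k8) i \<noteq> 0"
        by (metis leading_coeff_0_iff)
      then have "Polynomial.coeff L i \<noteq> 0"
        unfolding coeffs by (metis emb3_eq_iff ring_map.hom_zero[OF ring_map_emb3])
      then show ?thesis by auto
    qed
    ultimately show "associative_product ?P"
      using L R assoc by (metis smult_cancel)
  qed
qed

text \<open>Resolves the definite descriptions: existence is the descent of the product over the
  roots, uniqueness the injectivity of \<open>emb3\<close>.\<close>

lemma Lcoeff_eq: "Lcoeff i = Polynomial.coeff (left_poly K2 K4 K6 K8) i"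
  and Rcoeff_eq: "Rcoeff i = Polynomial.coeff (right_poly K2 K4 K6 K8) i"
proof -
  have lead: "eval2 base_emb (Fcoeff 2 generic_P2 0) u v =
      qa (base_emb K4) (base_emb K6) (base_emb K8) u v" for u v
  proof -
    have "eval2 base_emb (Fcoeff 2 generic_P2 0) u v =
        Polynomial.coeff (fiber base_emb generic_P2 u v) 2"
      by (simp add: fiber_def coeff_map_poly Fcoeff_def ring_map_base_emb)
    then show ?thesis
      by (simp add: generic_P2_def fiber_P2 ring_map_base_emb eval_nat_numeral)
  qed
  have Lpoly: "Lpoly = map_poly emb3 (left_poly K2 K4 K6 K8)"
    unfolding Lpoly_def lead unfolding generic_P2_def left_poly_def
    by (rule assoc_poly_eq_prod) (rule gens_at_0)+
  have "Polynomial.coeff Lpoly i = emb3 (Polynomial.coeff (left_poly K2 K4 K6 K8) i)"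
    unfolding Lpoly by (simp only: coeff_map_poly ring_map.hom_zero[OF ring_map_emb3])
  then show "Lcoeff i = Polynomial.coeff (left_poly K2 K4 K6 K8) i"
    by (simp only: Lcoeff_def emb3_eq_iff the_eq_trivial)
  have Rpoly: "Rpoly = map_poly emb3 (right_poly K2 K4 K6 K8)"
    unfolding Rpoly_def lead unfolding generic_P2_def right_poly_def
      gen_fiber_P2_commute[of _ _ _ _ gen_x]
    by (rule assoc_poly_eq_prod) (rule gens_at_0)+
  have "Polynomial.coeff Rpoly i = emb3 (Polynomial.coeff (right_poly K2 K4 K6 K8) i)"
    unfolding Rpoly by (simp only: coeff_map_poly ring_map.hom_zero[OF ring_map_emb3])
  then show "Rcoeff i = Polynomial.coeff (right_poly K2 K4 K6 K8) i"
    by (simp only: Rcoeff_def emb3_eq_iff the_eq_trivial)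
qed

section \<open>Symmetric polynomials satisfying the remaining axioms\<close>

text \<open>In this table the parameters are themselves coefficients, namely those of xyz, x^2 y z,
  x^2 y^2 z and x^2 y^2 z^2, so \<open>P2\<close> determines them.\<close>

lemma P2_pCons:
  "P2 k2 k4 k6 k8 =
     [:[:[:0, 0, 1:], [:0, - 2:], [:1:]:],
       [:[:0, - 2:], [:- 2, k2, k4:], [:0, k4, k6:]:],
       [:[:1:], [:0, k4, k6:], [:0, k6, k8:]:]:]"
  unfolding P2_eq_p2val p2val_def const3_def var_x_def var_y_def var_z_def
  by (simp add: power2_eq_square numeral_poly one_pCons)

lemma P2_eq_iff:
  "P2 k2 k4 k6 k8 = P2 l2 l4 l6 l8 \<longleftrightarrow> k2 = l2 \<and> k4 = l4 \<and> k6 = l6 \<and> k8 = l8"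
  by (auto simp: P2_pCons)

lemma P2_except_assoc: "nvalued_group_except_assoc 2 (P2 k2 k4 k6 k8)"
proof -
  have "degrees_le 2 (P2 k2 k4 k6 k8)"
    unfolding degrees_le_def P2_pCons by (auto simp: coeff_pCons split: nat.splits)
  moreover have "normalized 2 (P2 k2 k4 k6 k8)"
    by (simp add: normalized_def Fcoeff_def P2_pCons ring_map_ident numeral_2_eq_2)
  moreover have "neutral_zero 2 (P2 k2 k4 k6 k8)"
    by (simp add: neutral_zero_def Fcoeff_def P2_pCons ring_map_const_poly numeral_2_eq_2
        one_pCons numeral_poly)
  moreover have "has_inverse 2 (P2 k2 k4 k6 k8)"
    unfolding has_inverse_def
    \<comment> \<open>Every element is its own inverse, because F_2(x,y) is (x - y)^2.\<close>
    by (rule exI[of _ "[:0, 1:]"])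
      (simp add: Fcoeff_def P2_pCons ring_map_ident algebra_simps)
  ultimately show ?thesis by (simp add: nvalued_group_except_assoc_def)
qed

text \<open>A multiset determines its sum, its product and the product of all 1 + m; these yield the
  three elementary symmetric polynomials, through which \<open>p2val\<close> is defined.\<close>

lemma p2val_mset_cong:
  assumes "{#a, b, c#} = {#x, y, z#}"
  shows "p2val k2 k4 k6 k8 a b c = p2val k2 k4 k6 k8 x y z"
proof -
  have sum: "a + b + c = x + y + z"
    using arg_cong[OF assms, of sum_mset] by (simp add: add.assoc)
  have prod: "a * b * c = x * y * z"
    using arg_cong[OF assms, of prod_mset] by (simp add: mult.assoc)
  have "(1 + a) * (1 + b) * (1 + c) = (1 + x) * (1 + y) * (1 + z)"
    using arg_cong[OF assms, of "\<lambda>M. \<Prod>m\<in>#M. 1 + m"] by (simp add: mult.assoc)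
  moreover have "u * v + v * w + u * w = (1 + u) * (1 + v) * (1 + w) - 1 - (u + v + w) - u * v * w"
    for u v w :: 'a by (simp add: algebra_simps)
  ultimately have "a * b + b * c + a * c = x * y + y * z + x * z"
    by (simp only: sum prod)
  then show ?thesis
    by (simp only: p2val_def sum prod)
qed

lemma P2_symmetric: "symmetric_nvalued 2 (P2 k2 k4 k6 k8)"
  using p2val_mset_cong
  by (simp add: symmetric_nvalued_def Let_def eval3_P2 ring_map_const3) blast

lemma degree_le_2_pCons:
  assumes "Polynomial.degree p \<le> 2"
  shows "p = [:Polynomial.coeff p 0, Polynomial.coeff p 1, Polynomial.coeff p 2:]"
  using assms
  by (intro poly_eqI) (auto simp: coeff_pCons numeral_2_eq_2 split: nat.splits intro: coeff_eq_0)

text \<open>Two transpositions that generate all permutations of the variables act on the 3 by 3 by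
  3 array of coefficients by exchanging two of its directions.\<close>

lemma eval3_pCons_swap:
  fixes a0 a1 a2 a3 a4 a5 a6 a7 a8 b0 b1 b2 b3 b4 b5 b6 b7 b8 c0 c1 c2 c3 c4 c5 c6 c7 c8
    :: "'r::comm_ring_1"
  defines "P \<equiv>
    [:[:[:a0, a1, a2:], [:a3, a4, a5:], [:a6, a7, a8:]:],
      [:[:b0, b1, b2:], [:b3, b4, b5:], [:b6, b7, b8:]:],
      [:[:c0, c1, c2:], [:c3, c4, c5:], [:c6, c7, c8:]:]:]"
  shows "eval3 const3 P var_y var_x var_z =
    [:[:[:a0, a3, a6:], [:a1, a4, a7:], [:a2, a5, a8:]:],
      [:[:b0, b3, b6:], [:b1, b4, b7:], [:b2, b5, b8:]:],
      [:[:c0, c3, c6:], [:c1, c4, c7:], [:c2, c5, c8:]:]:]"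
    and "eval3 const3 P var_x var_z var_y =
    [:[:[:a0, a1, a2:], [:b0, b1, b2:], [:c0, c1, c2:]:],
      [:[:a3, a4, a5:], [:b3, b4, b5:], [:c3, c4, c5:]:],
      [:[:a6, a7, a8:], [:b6, b7, b8:], [:c6, c7, c8:]:]:]"
  by (simp_all only: P_def eval3_def fiber_pCons[OF ring_map_const3] eval2_pCons[OF ring_map_const3]
      map_poly_hom_pCons[OF ring_map_const3] poly_pCons map_poly_0 poly_0 mult_zero_right add_0_right)
    (simp_all add: const3_def var_x_def var_y_def var_z_def)

lemma eval3_vars: "eval3 const3 P var_x var_y var_z = P"
  by (rule poly3_hom_eqI[OF ring_map_eval3[OF ring_map_const3] ring_map_ident])
    (simp_all add: ring_map_const3)

text \<open>The degree bounds leave 27 coefficients, and symmetry groups them into ten orbits of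
  exponent triples. The neutral element and the normalization fix the six orbits with an exponent 0;
  the other four are free and become the parameters.\<close>

lemma symmetric_nvalued_imp_P2:
  fixes P :: "'r::comm_ring_1 poly poly poly"
  assumes "nvalued_group_except_assoc 2 P" and sym: "symmetric_nvalued 2 P"
  shows "\<exists>k2 k4 k6 k8. P = P2 k2 k4 k6 k8"
proof -
  from assms have deg: "degrees_le 2 P" and norm: "normalized 2 P" and neutral: "neutral_zero 2 P"
    by (simp_all add: nvalued_group_except_assoc_def)
  define p where "p i j k = Polynomial.coeff (Polynomial.coeff (Polynomial.coeff P k) j) i" for i j k
  have p1: "Polynomial.coeff (Polynomial.coeff P k) j = [:p 0 j k, p 1 j k, p 2 j k:]" for j k
    unfolding p_def using deg by (intro degree_le_2_pCons) (simp add: degrees_le_def)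
  have p2: "Polynomial.coeff P k = [:[:p 0 0 k, p 1 0 k, p 2 0 k:], [:p 0 1 k, p 1 1 k, p 2 1 k:],
      [:p 0 2 k, p 1 2 k, p 2 2 k:]:]" for k
    using deg by - (rule trans[OF degree_le_2_pCons], simp_all only: degrees_le_def p1 simp_thms)
  have P: "P = [:[:[:p 0 0 0, p 1 0 0, p 2 0 0:], [:p 0 1 0, p 1 1 0, p 2 1 0:], [:p 0 2 0, p 1 2 0, p 2 2 0:]:],
      [:[:p 0 0 1, p 1 0 1, p 2 0 1:], [:p 0 1 1, p 1 1 1, p 2 1 1:], [:p 0 2 1, p 1 2 1, p 2 2 1:]:],
      [:[:p 0 0 2, p 1 0 2, p 2 0 2:], [:p 0 1 2, p 1 1 2, p 2 1 2:], [:p 0 2 2, p 1 2 2, p 2 2 2:]:]:]"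
    using deg by - (rule trans[OF degree_le_2_pCons], simp_all only: degrees_le_def p2 simp_thms)
  have symQ: "eval3 const3 P a b c = eval3 const3 P var_x var_y var_z"
    if "{#a, b, c#} = {#var_x, var_y, var_z#}" for a b c
  proof -
    have "eval3 const3 P ((- 1)\<^sup>2 * a) ((- 1)\<^sup>2 * b) c =
        eval3 const3 P ((- 1)\<^sup>2 * var_x) ((- 1)\<^sup>2 * var_y) var_z"
      using sym that unfolding symmetric_nvalued_def Let_def by blast
    then show ?thesis by (simp only: power2_minus one_power2 mult_1_left)
  qed
  have "eval3 const3 P var_y var_x var_z = P"
    by (rule trans[OF symQ eval3_vars]) (rule add_mset_commute)
  then have xy: "p 1 0 0 = p 0 1 0 \<and> p 2 0 0 = p 0 2 0 \<and> p 2 1 0 = p 1 2 0 \<and>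
     p 1 0 1 = p 0 1 1 \<and> p 2 0 1 = p 0 2 1 \<and> p 2 1 1 = p 1 2 1 \<and>
     p 1 0 2 = p 0 1 2 \<and> p 2 0 2 = p 0 2 2 \<and> p 2 1 2 = p 1 2 2"
    unfolding P eval3_pCons_swap pCons_eq_iff by blast
  have "eval3 const3 P var_x var_z var_y = P"
    by (rule trans[OF symQ eval3_vars]) (rule arg_cong[OF add_mset_commute])
  then have yz: "p 0 1 0 = p 0 0 1 \<and> p 0 2 0 = p 0 0 2 \<and> p 0 2 1 = p 0 1 2 \<and>
     p 1 1 0 = p 1 0 1 \<and> p 1 2 0 = p 1 0 2 \<and> p 1 2 1 = p 1 1 2 \<and>
     p 2 1 0 = p 2 0 1 \<and> p 2 2 0 = p 2 0 2 \<and> p 2 2 1 = p 2 1 2"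
    unfolding P eval3_pCons_swap pCons_eq_iff by blast
  have 1: "p 0 0 2 = 1"
    using norm
    by (subst (asm) P) (simp add: normalized_def Fcoeff_def ring_map_ident numeral_2_eq_2)
  define c where "c k = [:p 0 0 k, p 0 1 k, p 0 2 k:]" for k
  \<comment> \<open>\<open>c k\<close> is the coefficient of z^k in P(z;0,y). As \<open>c 0\<close>
    is y^2 times \<open>c 2\<close> and has degree at most 2, \<open>c 2\<close> is constant, and
    the normalization makes it 1.\<close>
  have "[:c 0, c 1, c 2:] = Polynomial.smult (c 2) [:[:0, 0, 1:], [:0, - 2:], 1:]"
    using neutral unfolding P
    by (simp add: neutral_zero_def Fcoeff_def ring_map_const_poly numeral_2_eq_2 c_def)
  then have "p 0 0 0 = 0 \<and> p 0 1 0 = 0 \<and> p 0 1 2 = 0 \<and> p 0 2 2 = 0 \<and> p 0 1 1 = - 2"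
    by (simp add: c_def 1)
  with 1 xy yz have "P = P2 (p 1 1 1) (p 2 1 1) (p 2 2 1) (p 2 2 2)"
    by (subst P) (simp add: P2_pCons)
  then show ?thesis by blast
qed

section \<open>The quotient by the ideal of relations\<close>

lemma ring_of_type_algebra_simps [simp]:
  "carrier ring_of_type_algebra = UNIV"
  "x \<otimes>\<^bsub>ring_of_type_algebra\<^esub> y = x * y" "\<one>\<^bsub>ring_of_type_algebra\<^esub> = 1"
  "x \<oplus>\<^bsub>ring_of_type_algebra\<^esub> y = x + y" "\<zero>\<^bsub>ring_of_type_algebra\<^esub> = 0"
  by (simp_all add: ring_of_type_algebra_def)

lemma ring_map_iff_ring_hom:
  "ring_map f \<longleftrightarrow> f \<in> ring_hom ring_of_type_algebra ring_of_type_algebra"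
  by (auto simp: ring_map_def ring_hom_def)

lemma genideal_singleton:
  "genideal ring_of_type_algebra {a} = {p :: 'a::comm_ring_1. a dvd p}"
proof -
  interpret cring "ring_of_type_algebra :: 'a ring" by (rule cring_from_type_algebra)
  show ?thesis
    by (subst cgenideal_eq_genideal [symmetric]) (auto simp: cgenideal_def dvd_def mult.commute)
qed

lemma assoc_ideal_eq: "assoc_ideal = {p. assoc_rel K2 K4 K6 K8 dvd p}"
proof -
  interpret cring param4_ring by (rule cring_from_type_algebra)
  let ?r = "assoc_rel K2 K4 K6 K8"
  have ideal: "ideal assoc_ideal param4_ring"
    unfolding assoc_ideal_def by (rule genideal_ideal) simp
  \<comment> \<open>This is the relation with \<open>i = 0\<close> at the monomial x^6 y z.\<close>
  have "3 * ?r \<in> assoc_relations"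
    unfolding assoc_relations_def Lcoeff_eq Rcoeff_eq coeff_assoc_minor[symmetric] by blast
  then have "3 * ?r \<in> assoc_ideal"
    unfolding assoc_ideal_def using genideal_self[of assoc_relations] by auto
  \<comment> \<open>The constant 3 is invertible over the complex numbers, so the relation itself
    lies in the ideal.\<close>
  then have "const4 (1 / 3) * (3 * ?r) \<in> assoc_ideal"
    using ideal.I_l_closed[OF ideal, of _ "const4 (1 / 3)"] by simp
  also have "const4 (1 / 3) * (3 * ?r) = ?r"
    by (simp add: const4_def numeral_poly pCons_one flip: mult.assoc)
  finally have "genideal param4_ring {?r} \<subseteq> assoc_ideal"
    by (intro genideal_minimal ideal) simp
  moreover have "assoc_ideal \<subseteq> genideal param4_ring {?r}"
    unfolding assoc_ideal_def
  proof (rule genideal_minimal)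
    show "assoc_relations \<subseteq> genideal param4_ring {?r}"
      unfolding genideal_singleton assoc_relations_def Lcoeff_eq Rcoeff_eq assoc_minor_eq coeff_const3_mult
      by auto
  qed (simp add: genideal_ideal)
  ultimately show ?thesis by (simp add: genideal_singleton)
qed

lemma ideal_assoc_ideal: "ideal assoc_ideal param4_ring"
proof -
  interpret cring param4_ring by (rule cring_from_type_algebra)
  show ?thesis unfolding assoc_ideal_def by (rule genideal_ideal) simp
qed

lemma carrier_quot: "carrier (param4_ring Quot assoc_ideal) = range assoc_class"
  by (auto simp: FactRing_simps a_r_coset_def)

lemma assoc_class_hom: "assoc_class \<in> ring_hom param4_ring (param4_ring Quot assoc_ideal)"
  by (rule ideal.rcos_ring_hom[OF ideal_assoc_ideal])

lemma assoc_class_simps: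
  "assoc_class p \<otimes>\<^bsub>param4_ring Quot assoc_ideal\<^esub> assoc_class q = assoc_class (p * q)"
  "assoc_class p \<oplus>\<^bsub>param4_ring Quot assoc_ideal\<^esub> assoc_class q = assoc_class (p + q)"
  "\<one>\<^bsub>param4_ring Quot assoc_ideal\<^esub> = assoc_class 1"
  using ring_hom_mult[OF assoc_class_hom, of p q] ring_hom_add[OF assoc_class_hom, of p q]
    ring_hom_one[OF assoc_class_hom] by simp_all

text \<open>The first isomorphism theorem, with the value on every class recorded so that generators
  can be traced.\<close>

lemma quot_iso_exists:
  assumes f: "ring_map f" and surj: "surj f"
    and ker: "\<And>p. f p = 0 \<longleftrightarrow> assoc_rel K2 K4 K6 K8 dvd p"
  shows "\<exists>h \<in> ring_iso (param4_ring Quot assoc_ideal) ring_of_type_algebra.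
    \<forall>p. h (assoc_class p) = f p"
proof -
  interpret ring_hom_ring param4_ring ring_of_type_algebra f
    using f by (intro ring_hom_ringI2 ring_from_type_algebra) (simp add: ring_map_iff_ring_hom)
  have kernel: "a_kernel param4_ring ring_of_type_algebra f = assoc_ideal"
    by (simp only: a_kernel_def' assoc_ideal_eq ker ring_of_type_algebra_simps UNIV_I simp_thms)
  show ?thesis
  proof (intro bexI allI)
    show "(\<lambda>C. the_elem (f ` C)) \<in> ring_iso (param4_ring Quot assoc_ideal) ring_of_type_algebra"
      using FactRing_iso_set surj unfolding kernel by (simp only: ring_of_type_algebra_simps)
    show "the_elem (f ` assoc_class p) = f p" for p
      using the_elem_simp[of p] unfolding kernel by (simp only: ring_of_type_algebra_simps UNIV_I)
  qed
qed

text \<open>The relation is linear in the outermost variable \<open>K8\<close>, and this is its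
  root; evaluation there eliminates \<open>K8\<close>.\<close>

abbreviation k8_value :: param3 where "k8_value \<equiv> const3 (1 / 4) * (U4\<^sup>2 - U6 * U2)"

lemma const3_numeral: "const3 (numeral n) = numeral n" "const3 1 = 1"
  using ring_map.hom_numeral[OF ring_map_const3] ring_map.hom_one[OF ring_map_const3] by auto

lemma const3_mult_4: "4 * (const3 (1 / 4 :: complex) * p) = p"
proof -
  have "4 * (const3 (1 / 4 :: complex) * p) = const3 (4 * (1 / 4)) * p"
    unfolding ring_map.hom_mult[OF ring_map_const3] const3_numeral by (rule mult.assoc [symmetric])
  then show ?thesis by (simp add: const3_numeral)
qed

lemma poly_K:
  "poly (const4 c) v = const3 c" "poly K2 v = U2" "poly K4 v = U4" "poly K6 v = U6" "poly K8 v = v"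
  by (simp_all add: const4_def const3_def K2_def K4_def K6_def K8_def U2_def U4_def U6_def)

lemma linear_poly_simps:
  fixes a b c v :: "'a::comm_ring_1"
  shows "4 * [:0, 1:] - [:b:]\<^sup>2 + [:c:] * [:a:] = [:- (b\<^sup>2 - c * a), 4:]"
    and "4 * [:- v, 1:] = [:- (4 * v), 4:]"
    and "[:c:] * (4 * p) = Polynomial.smult (4 * c) p"
  by (simp_all add: numeral_poly power2_eq_square mult.commute)

text \<open>The relation is 4 times the monic linear polynomial with root \<open>k8_value\<close>,
  and 4 is a unit, so the factor theorem applies.\<close>

lemma poly_k8_value_eq_0_iff: "poly p k8_value = 0 \<longleftrightarrow> assoc_rel K2 K4 K6 K8 dvd p"
proof -
  have "assoc_rel K2 K4 K6 K8 = 4 * [:- k8_value, 1:]"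
    unfolding assoc_rel_def K2_def K4_def K6_def K8_def U2_def [symmetric] U4_def [symmetric]
      U6_def [symmetric] linear_poly_simps const3_mult_4 ..
  moreover have "[:const3 (1 / 4):] * (4 * [:- k8_value, 1:]) = [:- k8_value, 1:]"
    unfolding linear_poly_simps using const3_mult_4[of 1] by simp
  ultimately have "[:- k8_value, 1:] dvd assoc_rel K2 K4 K6 K8" "assoc_rel K2 K4 K6 K8 dvd [:- k8_value, 1:]"
    by (metis dvd_triv_right)+
  then show ?thesis
    unfolding poly_eq_0_iff_dvd by (blast intro: dvd_trans)
qed


section \<open>Doubling of the parameters k2, k4 and k6\<close>

definition scale2 :: "param3 \<Rightarrow> param3" where
  "scale2 q = eval3 const3 q (2 * U2) (2 * U4) (2 * U6)"

lemma U_eq_var: "U2 = var_x" "U4 = var_y" "U6 = var_z"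
  by (simp_all add: U2_def U4_def U6_def var_x_def var_y_def var_z_def)

lemma ring_map_scale2: "ring_map scale2"
  unfolding scale2_def by (intro ring_map_eval3 ring_map_const3)

lemma scale2_gens:
  "scale2 (const3 c) = const3 c" "scale2 U2 = 2 * U2" "scale2 U4 = 2 * U4" "scale2 U6 = 2 * U6"
  by (simp_all add: scale2_def ring_map_const3 U_eq_var)

text \<open>The inverse halves the variables; both composites fix the generators and so are the
  identity.\<close>

lemma bij_scale2: "bij scale2"
proof -
  define half where "half q = eval3 const3 q (const3 (1 / 2) * U2) (const3 (1 / 2) * U4)
    (const3 (1 / 2) * U6)" for q :: param3
  have half: "ring_map half"
    unfolding half_def by (intro ring_map_eval3 ring_map_const3)
  have half_gens: "half (const3 c) = const3 c" "half U2 = const3 (1 / 2) * U2"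
    "half U4 = const3 (1 / 2) * U4" "half U6 = const3 (1 / 2) * U6" for c
    by (simp_all add: half_def ring_map_const3 U_eq_var)
  have c2: "const3 (1 / 2 :: complex) * (2 * q) = q" "2 * (const3 (1 / 2 :: complex) * q) = q" for q
  proof -
    have "const3 (1 / 2 :: complex) * 2 = 1"
      unfolding const3_numeral [symmetric] ring_map.hom_mult[OF ring_map_const3, symmetric] by simp
    then show "const3 (1 / 2 :: complex) * (2 * q) = q" "2 * (const3 (1 / 2 :: complex) * q) = q"
      by (metis mult.assoc mult.commute mult_1)+
  qed
  note hom = ring_map.hom_mult[OF half] ring_map.hom_mult[OF ring_map_scale2]
    ring_map.hom_numeral[OF half] ring_map.hom_numeral[OF ring_map_scale2]
  have "half (scale2 q) = q" for q
    by (rule poly3_hom_eqI[OF ring_map_comp[OF ring_map_scale2 half] ring_map_ident])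
      (simp_all only: U_eq_var [symmetric] scale2_gens half_gens hom c2)
  moreover have "scale2 (half q) = q" for q
    by (rule poly3_hom_eqI[OF ring_map_comp[OF half ring_map_scale2] ring_map_ident])
      (simp_all only: U_eq_var [symmetric] scale2_gens half_gens hom c2)
  ultimately show ?thesis by (rule o_bij[OF ext ext, unfolded comp_def id_def])
qed

text \<open>\<open>k8_value\<close> is homogeneous of degree 2 in the variables, so doubling them
  gives a factor 4 that cancels 1/4.\<close>

lemma scale2_k8_value: "scale2 k8_value = U4\<^sup>2 - U6 * U2"
proof -
  have "scale2 k8_value = const3 (1 / 4) * ((2 * U4)\<^sup>2 - 2 * U6 * (2 * U2))"
    using ring_map_scale2
    by (simp only: ring_map.hom_mult ring_map.hom_diff ring_map.hom_power scale2_gens)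
  also have "\<dots> = 4 * (const3 (1 / 4) * (U4\<^sup>2 - U6 * U2))"
    by (simp only: power2_eq_square) (simp add: algebra_simps)
  finally show ?thesis unfolding const3_mult_4 .
qed

section \<open>Symmetric 2-valued groups over domains of characteristic zero\<close>

lemma P2_univ_eq: "P2_univ k2 k4 k6 = P2 (2 * k2) (2 * k4) (2 * k6) (k4\<^sup>2 - k6 * k2)"
  by (simp only: P2_univ_def P2_def ring_map.hom_mult[OF ring_map_const3] const3_numeral)

lemma assoc_rel_univ: "assoc_rel (2 * k2) (2 * k4) (2 * k6) (k4\<^sup>2 - k6 * k2) = 0"
  by (simp add: assoc_rel_def power2_eq_square algebra_simps)

lemma symmetric_nvalued_group_P2_iff:
  fixes k2 k4 k6 k8 :: "'r::{idom, ring_char_0}"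
  shows "symmetric_nvalued_group 2 (P2 k2 k4 k6 k8) \<longleftrightarrow> assoc_rel k2 k4 k6 k8 = 0"
  by (simp add: symmetric_nvalued_group_def nvalued_group_def P2_except_assoc P2_symmetric
      associative_product_P2_iff)

lemma symmetric_nvalued_group_iff:
  fixes P :: "'r::{idom, ring_char_0} poly poly poly"
  shows "symmetric_nvalued_group 2 P \<longleftrightarrow>
    (\<exists>k2 k4 k6 k8. P = P2 k2 k4 k6 k8 \<and> assoc_rel k2 k4 k6 k8 = 0)"
proof
  assume P: "symmetric_nvalued_group 2 P"
  then obtain k2 k4 k6 k8 where eq: "P = P2 k2 k4 k6 k8"
    using symmetric_nvalued_imp_P2[of P]
    unfolding symmetric_nvalued_group_def nvalued_group_def by blast
  with P have "assoc_rel k2 k4 k6 k8 = 0"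
    by (simp only: symmetric_nvalued_group_P2_iff)
  with eq show "\<exists>k2 k4 k6 k8. P = P2 k2 k4 k6 k8 \<and> assoc_rel k2 k4 k6 k8 = 0"
    by blast
qed (auto simp: symmetric_nvalued_group_P2_iff)

section \<open>Isomorphisms of the quotient with the polynomial ring in three variables\<close>

lemma surj_poly: "surj (\<lambda>p. poly p (a :: 'a::comm_semiring_0))"
  by (rule surjI[of _ "\<lambda>c. [:c:]"]) simp

lemma universal_iso:
  "\<exists>h \<in> ring_iso (param4_ring Quot assoc_ideal) param3_ring. \<forall>p. h (assoc_class p) = poly p k8_value"
  by (rule quot_iso_exists[OF ring_map_poly surj_poly poly_k8_value_eq_0_iff])

lemma universal_iso_scaled:
  "\<exists>h \<in> ring_iso (param4_ring Quot assoc_ideal) param3_ring.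
     \<forall>p. h (assoc_class p) = scale2 (poly p k8_value)"
proof (rule quot_iso_exists[OF ring_map_comp[OF ring_map_poly ring_map_scale2]])
  show "surj (\<lambda>p. scale2 (poly p k8_value))"
    using comp_surj[OF surj_poly bij_is_surj[OF bij_scale2]] by (simp only: comp_def)
  show "scale2 (poly p k8_value) = 0 \<longleftrightarrow> assoc_rel K2 K4 K6 K8 dvd p" for p
    using inj_eq[OF bij_is_inj[OF bij_scale2], of "poly p k8_value" 0]
    by (simp only: ring_map.hom_zero[OF ring_map_scale2] poly_k8_value_eq_0_iff)
qed

section \<open>Complex points of the quotient ring\<close>

lemma quotient_point_ring_map:
  assumes "\<phi> \<in> quotient_points"
  shows "ring_map (\<lambda>p. \<phi> (assoc_class p))"
    and "assoc_rel (\<phi> (assoc_class K2)) (\<phi> (assoc_class K4)) (\<phi> (assoc_class K6))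
      (\<phi> (assoc_class K8)) = 0"
proof -
  have \<phi>: "\<phi> \<in> ring_hom (param4_ring Quot assoc_ideal) complex_ring"
    using assms by (simp add: quotient_points_def)
  from ring_hom_trans[OF assoc_class_hom this]
  show hom: "ring_map (\<lambda>p. \<phi> (assoc_class p))"
    by (simp add: ring_map_iff_ring_hom comp_def)
  interpret cring param4_ring by (rule cring_from_type_algebra)
  \<comment> \<open>The relation lies in the ideal, so its class is zero and every point satisfies
    it.\<close>
  have "assoc_class (assoc_rel K2 K4 K6 K8) = assoc_class 0"
    using a_rcos_zero[OF ideal_assoc_ideal] by (simp add: assoc_ideal_eq)
  then have "\<phi> (assoc_class (assoc_rel K2 K4 K6 K8)) = 0"
    by (simp add: ring_map.hom_zero[OF hom])
  then show "assoc_rel (\<phi> (assoc_class K2)) (\<phi> (assoc_class K4)) (\<phi> (assoc_class K6))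
      (\<phi> (assoc_class K8)) = 0"
    by (simp add: ring_map.hom_assoc_rel[OF hom])
qed

lemma map_poly3_generic_P2:
  "ring_map f \<Longrightarrow> map_poly3 f generic_P2 = P2 (f K2) (f K4) (f K6) (f K8)"
  by (simp add: generic_P2_def map_poly3_P2)

text \<open>The specialized polynomial reveals the values of the point at \<open>K2\<close>,
  \<open>K4\<close>, \<open>K6\<close>, \<open>K8\<close>, which generate the ring together with the
  constants. Extensionality settles arguments outside the quotient.\<close>

lemma quotient_points_eqI:
  assumes \<phi>: "\<phi> \<in> quotient_points" and \<psi>: "\<psi> \<in> quotient_points"
    and eq: "map_poly3 (\<lambda>p. \<phi> (assoc_class p)) generic_P2 =
      map_poly3 (\<lambda>p. \<psi> (assoc_class p)) generic_P2"
  shows "\<phi> = \<psi>"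
proof (rule extensionalityI)
  show "\<phi> \<in> extensional (range assoc_class)" "\<psi> \<in> extensional (range assoc_class)"
    using \<phi> \<psi> by (simp_all add: quotient_points_def carrier_quot)
  have "\<phi> (assoc_class p) = \<psi> (assoc_class p)" for p
  proof (rule poly4_hom_eqI[of "\<lambda>p. \<phi> (assoc_class p)" "\<lambda>p. \<psi> (assoc_class p)"])
    show "ring_map (\<lambda>p. \<phi> (assoc_class p))" "ring_map (\<lambda>p. \<psi> (assoc_class p))"
      by (rule quotient_point_ring_map[OF \<phi>], rule quotient_point_ring_map[OF \<psi>])
    then show "\<phi> (assoc_class K2) = \<psi> (assoc_class K2)" "\<phi> (assoc_class K4) = \<psi> (assoc_class K4)"
      "\<phi> (assoc_class K6) = \<psi> (assoc_class K6)" "\<phi> (assoc_class K8) = \<psi> (assoc_class K8)"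
      using eq by (simp_all add: map_poly3_generic_P2 P2_eq_iff)
    show "\<phi> (assoc_class (const4 c)) = \<psi> (assoc_class (const4 c))" for c
      using \<phi> \<psi> by (simp add: quotient_points_def)
  qed
  then show "\<phi> C = \<psi> C" if "C \<in> range assoc_class" for C
    using that by auto
qed

text \<open>The point is evaluation at \<open>k2\<close>, \<open>k4\<close>, \<open>k6\<close> after
  the isomorphism with the ring in three variables.\<close>

lemma quotient_point_exists:
  fixes k2 k4 k6 k8 :: complex
  assumes "assoc_rel k2 k4 k6 k8 = 0"
  obtains \<phi> where "\<phi> \<in> quotient_points" "P2 k2 k4 k6 k8 = map_poly3 (\<lambda>p. \<phi> (assoc_class p)) generic_P2"
proof -
  obtain h where h: "\<And>p. h (assoc_class p) = poly p k8_value"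
    using universal_iso by blast
  define g where "g p = eval3 (\<lambda>c. c) (poly p k8_value) k2 k4 k6" for p :: param4
  define \<phi> where "\<phi> = restrict (\<lambda>C. eval3 (\<lambda>c. c) (h C) k2 k4 k6) (range assoc_class)"
  have \<phi>: "\<phi> (assoc_class p) = g p" for p
    by (simp add: \<phi>_def g_def h)
  have g: "ring_map g"
    unfolding g_def by (intro ring_map_comp[OF ring_map_poly ring_map_eval3] ring_map_ident)
  have const: "g (const4 c) = c" and gens: "g K2 = k2" "g K4 = k4" "g K6 = k6" for c
    unfolding g_def poly_K U_eq_var by (simp_all add: ring_map_ident)
  have "\<phi> \<in> ring_hom (param4_ring Quot assoc_ideal) complex_ring"
    by (rule ring_hom_memI)
      (auto simp: carrier_quot assoc_class_simps \<phi> ring_map.hom_mult[OF g] ring_map.hom_add[OF g]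
        ring_map.hom_one[OF g])
  then have in_points: "\<phi> \<in> quotient_points"
    by (simp add: quotient_points_def carrier_quot \<phi> const) (simp add: \<phi>_def)
  \<comment> \<open>The value at \<open>K8\<close> is found indirectly: it satisfies the relation,
    like that of any point, and the relation is linear in its last argument with the nonzero
    coefficient 4.\<close>
  have "assoc_rel k2 k4 k6 (g K8) = 0"
    using quotient_point_ring_map(2)[OF in_points] by (simp add: \<phi> gens)
  moreover have "assoc_rel k2 k4 k6 (g K8) - assoc_rel k2 k4 k6 k8 = 4 * (g K8 - k8)"
    by (simp add: assoc_rel_def algebra_simps)
  ultimately have "g K8 = k8" using assms by simp
  then have "P2 k2 k4 k6 k8 = map_poly3 (\<lambda>p. \<phi> (assoc_class p)) generic_P2"
    by (simp add: \<phi> map_poly3_generic_P2 g gens)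
  with in_points show thesis by (rule that)
qed

theorem theorem1:
  shows
    "(\<forall>P :: complex poly poly poly.
        nvalued_group_except_assoc 2 P \<and> symmetric_nvalued 2 P \<longleftrightarrow>
        (\<exists>k2 k4 k6 k8. P = P2 k2 k4 k6 k8)) \<and>
     assoc_ideal = genideal param4_ring {4 * K8 - K4\<^sup>2 + K6 * K2} \<and>
     (\<exists>h \<in> ring_iso (param4_ring Quot assoc_ideal) param3_ring.
        (\<forall>c. h (assoc_class (const4 c)) = const3 c) \<and>
        h (assoc_class K2) = U2 \<and> h (assoc_class K4) = U4 \<and> h (assoc_class K6) = U6) \<and>
     (\<forall>P :: complex poly poly poly.
        symmetric_nvalued_group 2 P \<longleftrightarrow>
        (\<exists>!\<phi>. \<phi> \<in> quotient_points \<and> P = map_poly3 (\<lambda>p. \<phi> (assoc_class p)) generic_P2)) \<and>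
     (\<exists>h \<in> ring_iso (param4_ring Quot assoc_ideal) param3_ring.
        (\<forall>c. h (assoc_class (const4 c)) = const3 c) \<and>
        h (assoc_class K2) = 2 * U2 \<and> h (assoc_class K4) = 2 * U4 \<and>
        h (assoc_class K6) = 2 * U6 \<and>
        map_poly3 (\<lambda>p. h (assoc_class p)) generic_P2 = P2_univ U2 U4 U6) \<and>
     symmetric_nvalued_group 2 (P2_univ U2 U4 U6) \<and>
     (\<forall>P :: complex poly poly poly.
        symmetric_nvalued_group 2 P \<longleftrightarrow>
        (\<exists>!k. case k of (k2, k4, k6) \<Rightarrow> P = P2_univ k2 k4 k6))"
proof (intro conjI allI)
  fix P :: "complex poly poly poly"
  show "nvalued_group_except_assoc 2 P \<and> symmetric_nvalued 2 P \<longleftrightarrow>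
      (\<exists>k2 k4 k6 k8. P = P2 k2 k4 k6 k8)"
    using symmetric_nvalued_imp_P2[of P] P2_except_assoc P2_symmetric by blast
  show "symmetric_nvalued_group 2 P \<longleftrightarrow>
      (\<exists>!\<phi>. \<phi> \<in> quotient_points \<and> P = map_poly3 (\<lambda>p. \<phi> (assoc_class p)) generic_P2)"
  proof
    assume "symmetric_nvalued_group 2 P"
    then obtain k2 k4 k6 k8 where "P = P2 k2 k4 k6 k8" "assoc_rel k2 k4 k6 k8 = 0"
      unfolding symmetric_nvalued_group_iff by blast
    then show "\<exists>!\<phi>. \<phi> \<in> quotient_points \<and> P = map_poly3 (\<lambda>p. \<phi> (assoc_class p)) generic_P2"
      using quotient_point_exists quotient_points_eqI by metis
  next
    assume "\<exists>!\<phi>. \<phi> \<in> quotient_points \<and> P = map_poly3 (\<lambda>p. \<phi> (assoc_class p)) generic_P2"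
    then obtain \<phi> where \<phi>: "\<phi> \<in> quotient_points"
        "P = map_poly3 (\<lambda>p. \<phi> (assoc_class p)) generic_P2" by blast
    then show "symmetric_nvalued_group 2 P"
      using quotient_point_ring_map[OF \<phi>(1)]
      by (simp add: map_poly3_generic_P2 symmetric_nvalued_group_P2_iff)
  qed
  show "symmetric_nvalued_group 2 P \<longleftrightarrow> (\<exists>!k. case k of (k2, k4, k6) \<Rightarrow> P = P2_univ k2 k4 k6)"
  proof
    assume "symmetric_nvalued_group 2 P"
    then obtain k2 k4 k6 k8 where P: "P = P2 k2 k4 k6 k8" and r: "assoc_rel k2 k4 k6 k8 = 0"
      unfolding symmetric_nvalued_group_iff by blast
    \<comment> \<open>Solving the relation for \<open>k8\<close> in the halved parameters gives
      exactly the coefficient of \<open>sigma3\<^sup>2\<close> in \<open>P2_univ\<close>.\<close>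
    from r have "k8 = (k4 / 2)\<^sup>2 - k6 / 2 * (k2 / 2)"
      by (simp add: assoc_rel_def power2_eq_square field_simps)
    with P have "P = P2_univ (k2 / 2) (k4 / 2) (k6 / 2)"
      by (simp add: P2_univ_eq)
    then show "\<exists>!k. case k of (k2, k4, k6) \<Rightarrow> P = P2_univ k2 k4 k6"
      by (intro ex1I[of _ "(k2 / 2, k4 / 2, k6 / 2)"]) (auto simp: P2_univ_eq P2_eq_iff)
  next
    assume "\<exists>!k. case k of (k2, k4, k6) \<Rightarrow> P = P2_univ k2 k4 k6"
    then show "symmetric_nvalued_group 2 P"
      by (auto simp: P2_univ_eq symmetric_nvalued_group_P2_iff assoc_rel_univ)
  qed
next
  show "assoc_ideal = genideal param4_ring {4 * K8 - K4\<^sup>2 + K6 * K2}"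
    by (simp add: assoc_ideal_eq genideal_singleton assoc_rel_def)
  show "symmetric_nvalued_group 2 (P2_univ U2 U4 U6)"
    by (simp add: P2_univ_eq symmetric_nvalued_group_P2_iff assoc_rel_univ)
  obtain h where h: "h \<in> ring_iso (param4_ring Quot assoc_ideal) param3_ring"
      "\<And>p. h (assoc_class p) = poly p k8_value"
    using universal_iso by blast
  show "\<exists>h \<in> ring_iso (param4_ring Quot assoc_ideal) param3_ring.
      (\<forall>c. h (assoc_class (const4 c)) = const3 c) \<and>
      h (assoc_class K2) = U2 \<and> h (assoc_class K4) = U4 \<and> h (assoc_class K6) = U6"
    by (intro bexI[OF _ h(1)] conjI allI) (simp_all only: h(2) poly_K)
next
  obtain h where h: "h \<in> ring_iso (param4_ring Quot assoc_ideal) param3_ring"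
      "\<And>p. h (assoc_class p) = scale2 (poly p k8_value)"
    using universal_iso_scaled by blast
  show "\<exists>h \<in> ring_iso (param4_ring Quot assoc_ideal) param3_ring.
      (\<forall>c. h (assoc_class (const4 c)) = const3 c) \<and>
      h (assoc_class K2) = 2 * U2 \<and> h (assoc_class K4) = 2 * U4 \<and> h (assoc_class K6) = 2 * U6 \<and>
      map_poly3 (\<lambda>p. h (assoc_class p)) generic_P2 = P2_univ U2 U4 U6"
  proof (intro bexI[OF _ h(1)] conjI allI)
    show "map_poly3 (\<lambda>p. h (assoc_class p)) generic_P2 = P2_univ U2 U4 U6"
      unfolding h(2) map_poly3_generic_P2[OF ring_map_comp[OF ring_map_poly ring_map_scale2]]
      by (simp only: poly_K scale2_gens scale2_k8_value P2_univ_eq)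
  qed (simp_all only: h(2) poly_K scale2_gens)
qed

end
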